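(* Let $F:\mathbb R^n\rightrightarrows\mathbb R^n$ be a multifunction with nonempty, convex, compact values which is Lipschitz continuous, i.e. there is $K>0$ with $F(x_2)\subseteq F(x_1)+K\|x_1-x_2\|\mathbb B^n$ for all $x_1,x_2$. Let $H(x,p)=\sup_{v\in F(x)}\langle p,v\rangle$ and assume: (H1) there is $c_0\ge 0$ such that for every $p\in\mathbb R^n$ the map $x\mapsto H(x,p)$ is semiconvex with semiconvexity constant $c_0\|p\|$; (H2) for every $p\neq 0$ the gradient $\nabla_pH(x,p)$ exists for all $x$ and there is $K_1\ge 0$ with $\|\nabla_pH(x,p)-\nabla_pH(y,p)\|\le K_1\|x-y\|$ for all $x,y\in\mathbb R^n$, $p\neq 0$. Let $\mathcal S\subseteq\mathbb R^n$ be closed and let $T$ be the associated minimum time function. Let $x\in\mathbb R^n\setminus\mathcal S$ with $T(x)<\infty$, let $x(\cdot)$ be an optimal trajectory starting from $x$ and reaching $\mathcal S$ at time $T(x)$, set $\bar x=x(T(x))$, and let $\xi$ be a unit vector in $N^P_{\overline{\mathbb R^n\setminus\mathcal S}}(\bar x)$ (a unit proximal inner normal to $\mathcal S$ at $\bar x$). Let $p:[0,T(x)]\to\mathbb R^n$ be an absolutely continuous arc with $p(t)\ne 0$ for all $t$ such that $$\dot x(t)=F_{p(t)}(x(t)),\qquad -\dot p(t)\in\partial_xH(x(t),p(t))\qquad\text{for a.e. } t\in[0,T(x)].$$ Then: (i) if $H(\bar x,\xi)\neq 0$ and $p(T(x))=\xi/H(\bar x,\xi)$, then $-p(t)\in\partial^PT(x(t))$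 for all $t\in[0,T(x))$; (ii) if $H(\bar x,\xi)=0$ and $p(T(x))=\xi$, then $-p(t)\in\partial^\infty T(x(t))$ for all $t\in[0,T(x))$.
   Context: Trajectories of $\dot x\in F(x)$ are absolutely continuous arcs $y(\cdot)$ with $\dot y(t)\in F(y(t))$ a.e. The minimum time function is $T(x)=\inf\{\tau>0:\ \exists$ a trajectory $y$ with $y(0)=x$, $y(\tau)\in\mathcal S\}$ (with $\inf\emptyset=+\infty$); an optimal trajectory from $x$ is a trajectory $x(\cdot)$ with $x(0)=x$ and $x(T(x))\in\mathcal S$. For $p\ne 0$, $F_p(x):=\nabla_pH(x,p)$. $\partial_xH(x,p)$ denotes Clarke's generalized gradient of $H(\cdot,p)$ at $x$. A vector $v$ is a proximal normal to a closed set $Q$ at $z\in Q$, written $v\in N^P_Q(z)$, if there is $\sigma\ge0$ with $\langle v,y-z\rangle\le\sigma\|y-z\|^2$ for all $y\in Q$. For an upper semicontinuous $f$, with $\mathrm{hypo} f=\{(y,\alpha):\alpha\le f(y)\}$: $\partial^Pf(y)=\{\zeta:(-\zeta,1)\in N^P_{\mathrm{hypo} f}(y,f(y))\}$ (proximal supergradients) and $\partial^\infty f(y)=\{\zeta:(-\zeta,0)\in N^P_{\mathrm{hypo} f}(y,f(y))\}$ (horizontal proximal supergradients). A function $h$ is semiconvex with constant $c$ if $-h$ is continuous and satisfies $\frac{-h(x_1)-h(x_2)}2+h(\frac{x_1+x_2}2)\le\frac c4\|x_1-x_2\|^2$. *)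

theory Defs
  imports "HOL-Analysis.Analysis" "HOL-Library.Liminf_Limsup"
begin

definition abs_cont_on :: "real set \<Rightarrow> (real \<Rightarrow> 'a::real_normed_vector) \<Rightarrow> bool" where
  "abs_cont_on I f \<longleftrightarrow>
     (\<forall>\<epsilon>>0. \<exists>\<delta>>0. \<forall>(n::nat) (a::nat \<Rightarrow> real) (b::nat \<Rightarrow> real).
        (\<forall>k<n. a k \<in> I \<and> b k \<in> I \<and> a k \<le> b k) \<and>
        (\<forall>i<n. \<forall>j<n. i \<noteq> j \<longrightarrow> b i \<le> a j \<or> b j \<le> a i) \<and>
        (\<Sum>k<n. b k - a k) < \<delta>
        \<longrightarrow> (\<Sum>k<n. norm (f (b k) - f (a k))) < \<epsilon>)"

definition trajectory_on :: "('a::euclidean_space \<Rightarrow> 'a set) \<Rightarrow> real \<Rightarrow> (real \<Rightarrow> 'a) \<Rightarrow> bool" where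
  "trajectory_on F \<tau> y \<longleftrightarrow> abs_cont_on {0..\<tau>} y \<and>
     (\<exists>N. negligible N \<and> (\<forall>t\<in>{0..\<tau>} - N. \<exists>v. (y has_vector_derivative v) (at t within {0..\<tau>}) \<and> v \<in> F (y t)))"

text \<open>Minimum time function (value +infinity when no trajectory reaches S).\<close>
definition min_time :: "('a::euclidean_space \<Rightarrow> 'a set) \<Rightarrow> 'a set \<Rightarrow> 'a \<Rightarrow> ereal" where
  "min_time F S x = Inf {ereal \<tau> | \<tau>. \<tau> > 0 \<and> (\<exists>y. trajectory_on F \<tau> y \<and> y 0 = x \<and> y \<tau> \<in> S)}"

definition Ham :: "('a::euclidean_space \<Rightarrow> 'a set) \<Rightarrow> 'a \<Rightarrow> 'a \<Rightarrow> real" where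
  "Ham F x p = (SUP v\<in>F x. p \<bullet> v)"

definition Fp :: "('a::euclidean_space \<Rightarrow> 'a set) \<Rightarrow> 'a \<Rightarrow> 'a \<Rightarrow> 'a" where
  "Fp F p x = (THE g. ((\<lambda>q. Ham F x q) has_derivative (\<lambda>q. g \<bullet> q)) (at p))"

definition clarke_dd :: "('a::euclidean_space \<Rightarrow> real) \<Rightarrow> 'a \<Rightarrow> 'a \<Rightarrow> ereal" where
  "clarke_dd f x v = Limsup (at (x, 0) within (UNIV \<times> {0<..}))
      (\<lambda>(y, t). ereal ((f (y + t *\<^sub>R v) - f y) / t))"

definition clarke_grad :: "('a::euclidean_space \<Rightarrow> real) \<Rightarrow> 'a \<Rightarrow> 'a set" where
  "clarke_grad f x = {\<zeta>. \<forall>v. ereal (\<zeta> \<bullet> v) \<le> clarke_dd f x v}"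

definition prox_normal :: "'a::real_inner set \<Rightarrow> 'a \<Rightarrow> 'a set" where
  "prox_normal Q z = {v. z \<in> Q \<and> (\<exists>\<sigma>\<ge>0. \<forall>y\<in>Q. v \<bullet> (y - z) \<le> \<sigma> * (norm (y - z))\<^sup>2)}"

definition hypo :: "('a \<Rightarrow> ereal) \<Rightarrow> ('a \<times> real) set" where
  "hypo f = {(y, \<alpha>). ereal \<alpha> \<le> f y}"

text \<open>Proximal supergradients and horizontal proximal supergradients
  (meaningful at points where f is finite).\<close>
definition prox_supergrad :: "('a::real_inner \<Rightarrow> ereal) \<Rightarrow> 'a \<Rightarrow> 'a set" where
  "prox_supergrad f y = {\<zeta>. (- \<zeta>, 1) \<in> prox_normal (hypo f) (y, real_of_ereal (f y))}"

definition horiz_prox_supergrad :: "('a::real_inner \<Rightarrow> ereal) \<Rightarrow> 'a \<Rightarrow> 'a set" where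
  "horiz_prox_supergrad f y = {\<zeta>. (- \<zeta>, 0) \<in> prox_normal (hypo f) (y, real_of_ereal (f y))}"

definition semiconvex_with :: "real \<Rightarrow> ('a::real_normed_vector \<Rightarrow> real) \<Rightarrow> bool" where
  "semiconvex_with c h \<longleftrightarrow> continuous_on UNIV (\<lambda>x. - h x) \<and>
     (\<forall>x1 x2. (- h x1 - h x2) / 2 + h ((1/2) *\<^sub>R (x1 + x2)) \<le> c / 4 * (norm (x1 - x2))\<^sup>2)"

end

theory Submission
  imports Defs
begin

text \<open>Fix \<open>t0 < T\<close> and a point \<open>y\<close> near \<open>x(t0)\<close>, and let \<open>y(\<cdot>)\<close> solve \<open>y' = F\<^bsub>p(t)\<^esub>(y)\<close>
  from \<open>y\<close>; this is a trajectory of \<open>F\<close> because \<open>F\<^sub>p(y)\<close> is the maximizer of \<open>p\<close> over \<open>F(y)\<close>.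
  Semiconvexity of \<open>H(\<cdot>,p)\<close> and the adjoint inclusion make \<open>\<langle>p, y - x\<rangle>\<close> nondecreasing up to an error
  \<open>O(|y - x(t0)|^2)\<close>, so at the terminal time \<open>y(\<cdot>)\<close> has moved at least
  \<open>\<langle>p(t0), y - x(t0)\<rangle>\<close> in the direction \<open>p(T)\<close>, a multiple of \<open>\<xi>\<close>. Running \<open>y(\<cdot>)\<close> for an extra (possibly
  negative) time \<open>\<theta>\<close> adds \<open>H(x(T),\<xi>) \<theta>\<close> along \<open>\<xi>\<close>, again up to second order.
  A point whose displacement along \<open>\<xi>\<close> exceeds \<open>\<sigma>\<close> times its squared distance to \<open>x(T)\<close> is interior to \<open>S\<close>; hence
  \<open>y(\<cdot>)\<close> would reach \<open>S\<close> strictly before time \<open>T - t0 + \<theta>\<close> unless a quadratic upper bound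
  holds, and that bound is the proximal inequality for the hypograph of the minimum time function.\<close>

section \<open>Absolutely continuous arcs\<close>

definition nonoverlapping :: "real set \<Rightarrow> nat \<Rightarrow> (nat \<Rightarrow> real) \<Rightarrow> (nat \<Rightarrow> real) \<Rightarrow> bool" where
  "nonoverlapping I n a b \<longleftrightarrow> (\<forall>k<n. a k \<in> I \<and> b k \<in> I \<and> a k \<le> b k) \<and>
     (\<forall>i<n. \<forall>j<n. i \<noteq> j \<longrightarrow> b i \<le> a j \<or> b j \<le> a i)"

lemma abs_cont_on_iff:
  "abs_cont_on I f \<longleftrightarrow> (\<forall>\<epsilon>>0. \<exists>\<delta>>0. \<forall>n a b. nonoverlapping I n a b \<longrightarrow>
     (\<Sum>k<n. b k - a k) < \<delta> \<longrightarrow> (\<Sum>k<n. norm (f (b k) - f (a k))) < \<epsilon>)"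
  unfolding abs_cont_on_def nonoverlapping_def by (simp only: imp_conjL conj_assoc)

lemma abs_cont_onE:
  assumes "abs_cont_on I f" "\<epsilon> > 0"
  obtains \<delta> where "\<delta> > 0"
    "\<And>n a b. nonoverlapping I n a b \<Longrightarrow> (\<Sum>k<n. b k - a k) < \<delta> \<Longrightarrow>
       (\<Sum>k<n. norm (f (b k) - f (a k))) < \<epsilon>"
proof -
  from assms(1)[unfolded abs_cont_on_iff, rule_format, OF assms(2)]
  obtain \<delta> where "\<delta> > 0"
    and D: "\<forall>n a b. nonoverlapping I n a b \<longrightarrow>
     (\<Sum>k<n. b k - a k) < \<delta> \<longrightarrow> (\<Sum>k<n. norm (f (b k) - f (a k))) < \<epsilon>"
    by (elim exE conjE)
  show thesis
    by (rule that[OF \<open>\<delta> > 0\<close>], rule D[rule_format])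
qed

lemma abs_cont_on_imp_continuous_on:
  assumes "abs_cont_on I f"
  shows "continuous_on I f"
  unfolding continuous_on_iff
proof (intro ballI allI impI)
  fix x \<epsilon> :: real assume x: "x \<in> I" and "\<epsilon> > 0"
  show "\<exists>d>0. \<forall>y\<in>I. dist y x < d \<longrightarrow> dist (f y) (f x) < \<epsilon>"
  proof (rule abs_cont_onE[OF assms \<open>\<epsilon> > 0\<close>], intro exI conjI ballI impI)
    fix \<delta> y assume "y \<in> I" "dist y x < \<delta>"
      and D: "\<And>n a b. nonoverlapping I n a b \<Longrightarrow> (\<Sum>k<n. b k - a k) < \<delta> \<Longrightarrow>
       (\<Sum>k<n. norm (f (b k) - f (a k))) < \<epsilon>"
    then show "dist (f y) (f x) < \<epsilon>"
      using D[of 1 "\<lambda>_. min x y" "\<lambda>_. max x y"] x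
      by (cases "x \<le> y") (auto simp: dist_norm min_def max_def norm_minus_commute nonoverlapping_def)
  qed
qed

text \<open>Absolute continuity sees only increments, so a bound on increments transfers it.
  Lipschitz maps, inner products of bounded arcs and arcs that agree on an interval are all treated
  through this bound.\<close>

lemma abs_cont_on_dominated:
  assumes f: "abs_cont_on I f" and g: "abs_cont_on I g"
    and dom: "\<And>s t. s \<in> I \<Longrightarrow> t \<in> I \<Longrightarrow> norm (h t - h s) \<le> B * norm (f t - f s) + C * norm (g t - g s)"
  shows "abs_cont_on I h"
  unfolding abs_cont_on_iff
proof (intro allI impI)
  fix \<epsilon> :: real assume "\<epsilon> > 0"
  \<comment> \<open>The signs of \<open>B\<close> and \<open>C\<close> are arbitrary; the summand 1
    makes the common majorant positive, so that dividing by \<open>2 * A\<close> is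
    legitimate.\<close>
  define A where "A = \<bar>B\<bar> + \<bar>C\<bar> + 1"
  have A: "A > 0" "B \<le> A" "C \<le> A" by (auto simp: A_def)
  have e: "\<epsilon> / (2 * A) > 0" using \<open>\<epsilon> > 0\<close> A by simp
  obtain d1 where d1: "d1 > 0" and
    D1: "\<And>n a b. nonoverlapping I n a b \<Longrightarrow> (\<Sum>k<n. b k - a k) < d1 \<Longrightarrow>
       (\<Sum>k<n. norm (f (b k) - f (a k))) < \<epsilon> / (2 * A)"
    by (rule abs_cont_onE[OF f e], rule that)
  obtain d2 where d2: "d2 > 0" and
    D2: "\<And>n a b. nonoverlapping I n a b \<Longrightarrow> (\<Sum>k<n. b k - a k) < d2 \<Longrightarrow>
       (\<Sum>k<n. norm (g (b k) - g (a k))) < \<epsilon> / (2 * A)"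
    by (rule abs_cont_onE[OF g e], rule that)
  show "\<exists>\<delta>>0. \<forall>n a b. nonoverlapping I n a b \<longrightarrow>
     (\<Sum>k<n. b k - a k) < \<delta> \<longrightarrow> (\<Sum>k<n. norm (h (b k) - h (a k))) < \<epsilon>"
  proof (intro exI[of _ "min d1 d2"] conjI allI impI)
    fix n a b
    assume H: "nonoverlapping I n a b" and len: "(\<Sum>k<n. b k - a k) < min d1 d2"
    have "(\<Sum>k<n. norm (h (b k) - h (a k))) \<le> (\<Sum>k<n. A * norm (f (b k) - f (a k)) + A * norm (g (b k) - g (a k)))"
    proof (rule sum_mono)
      fix k assume "k \<in> {..<n}"
      then have "norm (h (b k) - h (a k)) \<le> B * norm (f (b k) - f (a k)) + C * norm (g (b k) - g (a k))"
        using H dom by (auto simp: nonoverlapping_def)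
      also have "\<dots> \<le> A * norm (f (b k) - f (a k)) + A * norm (g (b k) - g (a k))"
        using A by (intro add_mono mult_right_mono) auto
      finally show "norm (h (b k) - h (a k)) \<le> A * norm (f (b k) - f (a k)) + A * norm (g (b k) - g (a k))" .
    qed
    also have "\<dots> = A * (\<Sum>k<n. norm (f (b k) - f (a k))) + A * (\<Sum>k<n. norm (g (b k) - g (a k)))"
      by (simp add: sum.distrib sum_distrib_left)
    also have "\<dots> < A * (\<epsilon> / (2 * A)) + A * (\<epsilon> / (2 * A))"
      using D1[OF H] D2[OF H] len A by (intro add_strict_mono mult_strict_left_mono) auto
    also have "\<dots> = \<epsilon>" using A by simp
    finally show "(\<Sum>k<n. norm (h (b k) - h (a k))) < \<epsilon>" .
  qed (use d1 d2 in auto)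
qed

lemma abs_cont_on_ident: "abs_cont_on I (\<lambda>t::real. t)"
  unfolding abs_cont_on_iff
proof (intro allI impI exI conjI)
  fix \<epsilon> :: real and n a b
  assume "nonoverlapping I n a b" and len: "(\<Sum>k<n. b k - a k) < \<epsilon>"
  then have "(\<Sum>k<n. norm (b k - a k)) = (\<Sum>k<n. b k - a k)"
    by (intro sum.cong) (auto simp: nonoverlapping_def)
  with len show "(\<Sum>k<n. norm (b k - a k)) < \<epsilon>" by simp
qed

lemma abs_cont_on_lipschitz:
  assumes "\<And>s t. s \<in> I \<Longrightarrow> t \<in> I \<Longrightarrow> norm (h t - h s) \<le> B * \<bar>t - s\<bar>"
  shows "abs_cont_on I h"
  by (rule abs_cont_on_dominated[OF abs_cont_on_ident abs_cont_on_ident, where B=B and C=0])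
     (use assms in auto)

lemma abs_cont_on_subset:
  assumes "abs_cont_on I f" "J \<subseteq> I"
  shows "abs_cont_on J f"
proof -
  have "nonoverlapping J n a b \<Longrightarrow> nonoverlapping I n a b" for n a b
    using assms(2) by (auto simp: nonoverlapping_def)
  then show ?thesis using assms(1) unfolding abs_cont_on_iff by meson
qed

lemma abs_cont_on_shift:
  assumes f: "abs_cont_on I f" and sub: "\<And>t. t \<in> J \<Longrightarrow> t + c \<in> I"
  shows "abs_cont_on J (\<lambda>t. f (t + c))"
  unfolding abs_cont_on_iff
proof (intro allI impI)
  fix \<epsilon> :: real assume "\<epsilon> > 0"
  obtain \<delta> where \<delta>: "\<delta> > 0" and
    D: "\<And>n a b. nonoverlapping I n a b \<Longrightarrow> (\<Sum>k<n. b k - a k) < \<delta> \<Longrightarrow>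
       (\<Sum>k<n. norm (f (b k) - f (a k))) < \<epsilon>"
    by (rule abs_cont_onE[OF f \<open>\<epsilon> > 0\<close>], rule that)
  have "nonoverlapping J n a b \<Longrightarrow> nonoverlapping I n (\<lambda>k. a k + c) (\<lambda>k. b k + c)" for n a b
    using sub by (auto simp: nonoverlapping_def)
  from D[OF this] \<delta> show "\<exists>\<delta>>0. \<forall>n a b. nonoverlapping J n a b \<longrightarrow>
     (\<Sum>k<n. b k - a k) < \<delta> \<longrightarrow> (\<Sum>k<n. norm (f (b k + c) - f (a k + c))) < \<epsilon>"
    by (intro exI[of _ \<delta>]) auto
qed

text \<open>Each interval is cut at \<open>c\<close> into a left and a right part, possibly
  degenerate. Both families stay nonoverlapping with no larger total length, and the triangle
  inequality through \<open>f c\<close> bounds the original increments by those of the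
  parts.\<close>

lemma abs_cont_on_join:
  fixes f :: "real \<Rightarrow> 'a::real_normed_vector"
  assumes f1: "abs_cont_on {a..c} f" and f2: "abs_cont_on {c..b} f" and c: "a \<le> c" "c \<le> b"
  shows "abs_cont_on {a..b} f"
  unfolding abs_cont_on_iff
proof (intro allI impI)
  fix \<epsilon> :: real assume "\<epsilon> > 0"
  then have e: "\<epsilon> / 2 > 0" by simp
  obtain d1 where d1: "d1 > 0" and
    D1: "\<And>n u v. nonoverlapping {a..c} n u v \<Longrightarrow> (\<Sum>k<n. v k - u k) < d1 \<Longrightarrow>
       (\<Sum>k<n. norm (f (v k) - f (u k))) < \<epsilon> / 2"
    by (rule abs_cont_onE[OF f1 e], rule that)
  obtain d2 where d2: "d2 > 0" and
    D2: "\<And>n u v. nonoverlapping {c..b} n u v \<Longrightarrow> (\<Sum>k<n. v k - u k) < d2 \<Longrightarrow>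
       (\<Sum>k<n. norm (f (v k) - f (u k))) < \<epsilon> / 2"
    by (rule abs_cont_onE[OF f2 e], rule that)
  show "\<exists>\<delta>>0. \<forall>n u v. nonoverlapping {a..b} n u v \<longrightarrow>
     (\<Sum>k<n. v k - u k) < \<delta> \<longrightarrow> (\<Sum>k<n. norm (f (v k) - f (u k))) < \<epsilon>"
  proof (intro exI[of _ "min d1 d2"] conjI allI impI)
    fix n u v
    assume no: "nonoverlapping {a..b} n u v" and "(\<Sum>k<n. v k - u k) < min d1 d2"
    then have uv: "\<And>k. k < n \<Longrightarrow> u k \<in> {a..b} \<and> v k \<in> {a..b} \<and> u k \<le> v k"
      and len: "(\<Sum>k<n. v k - u k) < d1" "(\<Sum>k<n. v k - u k) < d2" by (auto simp: nonoverlapping_def)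
    have "(\<Sum>k<n. min (v k) c - min (u k) c) \<le> (\<Sum>k<n. v k - u k)"
         "(\<Sum>k<n. max (v k) c - max (u k) c) \<le> (\<Sum>k<n. v k - u k)"
      by (rule sum_mono, use uv in \<open>fastforce simp: min_def max_def\<close>)+
    moreover have disj: "v i \<le> u j \<or> v j \<le> u i" if "i < n" "j < n" "i \<noteq> j" for i j
      using no that by (auto simp: nonoverlapping_def)
    have "nonoverlapping {a..c} n (\<lambda>k. min (u k) c) (\<lambda>k. min (v k) c)"
      unfolding nonoverlapping_def
    proof (intro conjI allI impI)
      fix i j assume "i < n" "j < n" "i \<noteq> j"
      from disj[OF this] show "min (v i) c \<le> min (u j) c \<or> min (v j) c \<le> min (u i) c"
        by (metis min.mono order_refl)
    qed (use uv c in \<open>auto intro!: min.mono simp: min_le_iff_disj\<close>)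
    moreover have "nonoverlapping {c..b} n (\<lambda>k. max (u k) c) (\<lambda>k. max (v k) c)"
      unfolding nonoverlapping_def
    proof (intro conjI allI impI)
      fix i j assume "i < n" "j < n" "i \<noteq> j"
      from disj[OF this] show "max (v i) c \<le> max (u j) c \<or> max (v j) c \<le> max (u i) c"
        by (metis max.mono order_refl)
    qed (use uv c in \<open>auto intro!: max.mono simp: le_max_iff_disj\<close>, meson linear order_trans uv)
    ultimately have
      "(\<Sum>k<n. norm (f (min (v k) c) - f (min (u k) c))) < \<epsilon> / 2"
      "(\<Sum>k<n. norm (f (max (v k) c) - f (max (u k) c))) < \<epsilon> / 2"
      using D1 D2 len by (meson le_less_trans)+
    moreover have "norm (f (v k) - f (u k)) \<le> norm (f (min (v k) c) - f (min (u k) c)) + norm (f (max (v k) c) - f (max (u k) c))" if "k < n" for k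
      using uv[OF that] norm_triangle_ineq[of "f c - f (u k)" "f (v k) - f c"]
      by (auto simp: min_def max_def)
    then have "(\<Sum>k<n. norm (f (v k) - f (u k))) \<le> (\<Sum>k<n. norm (f (min (v k) c) - f (min (u k) c))) + (\<Sum>k<n. norm (f (max (v k) c) - f (max (u k) c)))"
      unfolding sum.distrib[symmetric] by (intro sum_mono) auto
    ultimately show "(\<Sum>k<n. norm (f (v k) - f (u k))) < \<epsilon>" by linarith
  qed (use d1 d2 in auto)
qed

text \<open>The integral is the gauge integral, and integrability of \<open>g\<close> is part of the
  conclusion. On intervals tagged outside \<open>N\<close> differentiability controls the Riemann
  sum; those tagged in \<open>N\<close> have small total length, so absolute continuity makes the
  increments of \<open>f\<close> over them small.\<close>

lemma abs_cont_on_fundamental_theorem: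
  fixes f :: "real \<Rightarrow> 'a::banach"
  assumes ab: "a \<le> b" and ac: "abs_cont_on {a..b} f" and N: "negligible N"
    and der: "\<And>t. t \<in> {a..b} - N \<Longrightarrow> (f has_vector_derivative g t) (at t within {a..b})"
  shows "(g has_integral (f b - f a)) {a..b}"
proof -
  \<comment> \<open>On \<open>N\<close> nothing is known about \<open>g\<close>, so it is replaced
    by zero there; the spike rule restores \<open>g\<close> at the end.\<close>
  define h where "h t = (if t \<in> N then 0 else g t)" for t
  have "(h has_integral (f b - f a)) {a..b}"
    unfolding has_integral_real
  proof (intro allI impI)
    fix e :: real assume "e > 0"
    \<comment> \<open>The 1 in the denominator covers \<open>a = b\<close> and keeps
      \<open>e' * (b - a)\<close> strictly below \<open>e / 2\<close>.\<close>
    define e' where "e' = e / (2 * (b - a + 1))"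
    have e': "e' > 0" using \<open>e > 0\<close> ab by (simp add: e'_def)
    have "\<exists>d>0. x \<in> {a..b} - N \<longrightarrow>
         (\<forall>y\<in>{a..b}. norm (y-x) < d \<longrightarrow> norm (f y - f x - (y-x) *\<^sub>R g x) \<le> e' * norm (y-x))" for x
    proof (cases "x \<in> {a..b} - N")
      case True
      from der[OF this, unfolded has_vector_derivative_def has_derivative_within_alt] e'
      show ?thesis by blast
    qed (auto intro: exI[of _ 1])
    then obtain d where d: "\<And>x. 0 < d x"
                   "\<And>x y. \<lbrakk>x \<in> {a..b}; x \<notin> N; y \<in> {a..b}; norm (y-x) < d x\<rbrakk>
                          \<Longrightarrow> norm (f y - f x - (y-x) *\<^sub>R g x) \<le> e' * norm (y-x)"
      by (metis DiffI)
    have "e / 2 > 0" using \<open>e > 0\<close> by simp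
    obtain \<delta> where \<delta>: "\<delta> > 0" and
      D: "\<And>n u v. nonoverlapping {a..b} n u v \<Longrightarrow> (\<Sum>k<n. v k - u k) < \<delta> \<Longrightarrow>
         (\<Sum>k<n. norm (f (v k) - f (u k))) < e / 2"
      by (rule abs_cont_onE[OF ac \<open>e / 2 > 0\<close>], rule that)
    \<comment> \<open>A Riemann sum of this indicator is the total length of the intervals tagged in
      \<open>N\<close>, so a suitable gauge pushes that length below \<delta>.\<close>
    have "((indicator N :: real \<Rightarrow> real) has_integral 0) {a..b}"
      using N[unfolded negligible_def, rule_format, of a b] by simp
    from this[unfolded has_integral_real, rule_format, OF \<delta>]
    obtain \<gamma> where \<gamma>: "gauge \<gamma>" and
      G: "\<forall>p. p tagged_division_of {a..b} \<and> \<gamma> fine p \<longrightarrow>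
          norm ((\<Sum>(x, k)\<in>p. measure lborel k *\<^sub>R (indicator N x :: real)) - 0) < \<delta>"
      by (elim exE conjE)
    show "\<exists>\<gamma>. gauge \<gamma> \<and> (\<forall>p. p tagged_division_of {a..b} \<and> \<gamma> fine p \<longrightarrow>
        norm ((\<Sum>(x,k)\<in>p. measure lborel k *\<^sub>R h x) - (f b - f a)) < e)"
    proof (intro exI[of _ "\<lambda>x. ball x (d x) \<inter> \<gamma> x"] conjI allI impI)
      show "gauge (\<lambda>x. ball x (d x) \<inter> \<gamma> x)"
        by (intro gauge_Int gauge_ball_dependent \<gamma>) (use d(1) in blast)
      fix p assume "p tagged_division_of {a..b} \<and> (\<lambda>x. ball x (d x) \<inter> \<gamma> x) fine p"
      then have p: "p tagged_division_of {a..b}" and fine1: "(\<lambda>x. ball x (d x)) fine p" and fine2: "\<gamma> fine p"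
        by (auto simp: fine_Int)
      have fin: "finite p" using p by (rule tagged_division_of_finite)
      have K: "\<exists>u v. k = {u..v} \<and> u \<le> v \<and> x \<in> {u..v} \<and> {u..v} \<subseteq> {a..b} \<and> Inf k = u \<and> Sup k = v \<and> measure lborel k = v - u"
        if xk: "(x, k) \<in> p" for x k
      proof -
        obtain u v where k: "k = cbox u v" using tagged_division_ofD(4)[OF p xk] by blast
        moreover have "x \<in> k" "k \<subseteq> {a..b}" using tagged_division_ofD(2,3)[OF p xk] by blast+
        moreover have "u \<le> v" using k \<open>x \<in> k\<close> by auto
        ultimately show ?thesis by auto
      qed
      \<comment> \<open>Only intervals of positive length are kept: for them disjoint interiors
        force one to end before the other begins. Degenerate intervals contribute no
        increment.\<close>
      define q where "q = {z \<in> p. fst z \<in> N \<and> measure lborel (snd z) > 0}"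
      have finq: "finite q" "q \<subseteq> p" using fin by (auto simp: q_def)
      have "norm ((\<Sum>(x,k)\<in>p. measure lborel k *\<^sub>R h x) - (f b - f a))
          = norm (\<Sum>(x, k)\<in>p. measure lborel k *\<^sub>R h x - (f (Sup k) - f (Inf k)))"
        using additive_tagged_division_1[OF ab p, of f] by (simp add: sum_subtractf split_def)
      also have "\<dots> \<le> (\<Sum>z\<in>p. e' * measure lborel (snd z) + (if z \<in> q then norm (f (Sup (snd z)) - f (Inf (snd z))) else 0))"
      proof (rule sum_norm_le, safe)
        fix x k assume xk: "(x, k) \<in> p"
        then obtain u v where k: "k = {u..v}" "u \<le> v" "x \<in> {u..v}" "{u..v} \<subseteq> {a..b}" "Inf k = u" "Sup k = v" "measure lborel k = v - u"
          using K by blast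
        show "norm (measure lborel k *\<^sub>R h x - (f (Sup k) - f (Inf k))) \<le> 
          e' * measure lborel (snd (x, k)) + (if (x, k) \<in> q then norm (f (Sup (snd (x, k))) - f (Inf (snd (x, k)))) else 0)"
        proof (cases "x \<in> N")
          case True
          have "norm (f v - f u) = 0" if "(x, k) \<notin> q" using that True xk k by (auto simp: q_def)
          then show ?thesis using True e' k by (auto simp: h_def norm_minus_commute)
        next
          case False
          then have nq: "(x, k) \<notin> q" by (simp add: q_def)
          have ball: "\<forall>y\<in>k. norm (y - x) < d x"
            using fine1 xk by (fastforce simp: fine_def dist_norm norm_minus_commute)
          \<comment> \<open>Straddle estimate: the tag \<open>x\<close> lies between
            \<open>u\<close> and \<open>v\<close>, so the two distances to it add up to exactly
            \<open>v - u\<close>.\<close>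
          have "norm ((v - u) *\<^sub>R g x - (f v - f u)) = norm (f u - f x - (u - x) *\<^sub>R g x - (f v - f x - (v - x) *\<^sub>R g x))"
            by (auto simp: algebra_simps)
          also have "\<dots> \<le> norm (f u - f x - (u - x) *\<^sub>R g x) + norm (f v - f x - (v - x) *\<^sub>R g x)"
            by (rule norm_triangle_ineq4)
          also have "\<dots> \<le> e' * norm (u - x) + e' * norm (v - x)"
            using bspec[OF ball, of u] bspec[OF ball, of v] k False by (intro add_mono d) auto
          also have "\<dots> = e' * (v - u)"
            using k by (auto simp: algebra_simps)
          finally show ?thesis using k nq False by (simp add: h_def)
        qed
      qed
      also have "\<dots> = e' * (\<Sum>z\<in>p. measure lborel (snd z)) + (\<Sum>z\<in>q. norm (f (Sup (snd z)) - f (Inf (snd z))))"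
        by (simp only: sum.distrib sum_distrib_left sum.inter_restrict[OF fin, symmetric] Int_absorb1[OF finq(2)])
      also have "(\<Sum>z\<in>p. measure lborel (snd z)) = b - a"
        using additive_content_tagged_division[of p a b] p ab by (simp add: split_def)
      also have "e' * (b - a) < e / 2"
        using \<open>e > 0\<close> ab by (simp add: e'_def divide_simps)
      also have "(\<Sum>z\<in>q. norm (f (Sup (snd z)) - f (Inf (snd z)))) < e / 2"
      proof -
        obtain \<phi> where \<phi>: "bij_betw \<phi> {..<card q} q"
          using ex_bij_betw_nat_finite[OF finq(1)] atLeast0LessThan by metis
        have re: "(\<Sum>z\<in>q. F z) = (\<Sum>i<card q. F (\<phi> i))" for F :: "_ \<Rightarrow> real"
          using sum.reindex_bij_betw[OF \<phi>, of F] by simp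
        have \<phi>q: "\<phi> i \<in> q" if "i < card q" for i using \<phi> that by (auto simp: bij_betw_def)
        have "(\<Sum>i<card q. norm (f (Sup (snd (\<phi> i))) - f (Inf (snd (\<phi> i))))) < e / 2"
        proof (rule D)
          show "nonoverlapping {a..b} (card q) (\<lambda>i. Inf (snd (\<phi> i))) (\<lambda>i. Sup (snd (\<phi> i)))"
            unfolding nonoverlapping_def
          proof (intro conjI allI impI)
            fix i assume "i < card q"
            then have "(fst (\<phi> i), snd (\<phi> i)) \<in> p" using \<phi>q finq by auto
            from K[OF this] show "Inf (snd (\<phi> i)) \<in> {a..b}" "Sup (snd (\<phi> i)) \<in> {a..b}" "Inf (snd (\<phi> i)) \<le> Sup (snd (\<phi> i))"
              by auto
          next
            fix i j assume ij: "i < card q" "j < card q" "i \<noteq> j"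
            then have ne: "\<phi> i \<noteq> \<phi> j" using \<phi> by (auto simp: bij_betw_def inj_on_def)
            obtain x k where xk: "\<phi> i = (x, k)" by (cases "\<phi> i")
            obtain y l where yl: "\<phi> j = (y, l)" by (cases "\<phi> j")
            have inp: "(x, k) \<in> p" "(y, l) \<in> p" "measure lborel k > 0" "measure lborel l > 0" 
              using \<phi>q[OF ij(1)] \<phi>q[OF ij(2)] xk yl by (auto simp: q_def)
            obtain u v where k: "k = {u..v}" "Inf k = u" "Sup k = v" "measure lborel k = v - u" using K[OF inp(1)] by blast
            obtain u' v' where l: "l = {u'..v'}" "Inf l = u'" "Sup l = v'" "measure lborel l = v' - u'" using K[OF inp(2)] by blast
            have "interior k \<inter> interior l = {}"
              using p inp ne xk yl by (metis tagged_division_ofD(5))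
            then have "{u<..<v} \<inter> {u'<..<v'} = {}" by (simp add: k l)
            moreover have "u < v" "u' < v'" using k l inp by auto
            ultimately have "v \<le> u' \<or> v' \<le> u" 
              by (auto simp: Int_greaterThanLessThan greaterThanLessThan_empty_iff max_def min_def split: if_splits)
            then show "Sup (snd (\<phi> i)) \<le> Inf (snd (\<phi> j)) \<or> Sup (snd (\<phi> j)) \<le> Inf (snd (\<phi> i))"
              using k l xk yl by simp
          qed
          have "(\<Sum>i<card q. Sup (snd (\<phi> i)) - Inf (snd (\<phi> i))) = (\<Sum>z\<in>q. measure lborel (snd z))"
            unfolding re using \<phi>q finq K by (intro sum.cong) (auto, metis K prod.collapse subsetD)
          also have "\<dots> = (\<Sum>z\<in>p. if z \<in> q then measure lborel (snd z) else 0)"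
            using fin finq by (simp add: sum.inter_restrict[symmetric] Int_absorb1)
          also have "\<dots> \<le> (\<Sum>(x, k)\<in>p. measure lborel k *\<^sub>R (indicator N x :: real))"
            by (rule sum_mono) (auto simp: q_def indicator_def split_def)
          also have "\<dots> < \<delta>" using G p fine2 by auto
          finally show "(\<Sum>i<card q. Sup (snd (\<phi> i)) - Inf (snd (\<phi> i))) < \<delta>" .
        qed
        then show ?thesis unfolding re .
      qed
      finally show "norm ((\<Sum>(x,k)\<in>p. measure lborel k *\<^sub>R h x) - (f b - f a)) < e" by simp
    qed
  qed
  then show ?thesis
    by (rule has_integral_spike[OF N, rotated]) (simp add: h_def)
qed

section \<open>Differential equations with a Lipschitz right-hand side\<close>

lemma continuous_on_lipschitz_compose:
  fixes f :: "'b::topological_space \<Rightarrow> 'a::real_normed_vector \<Rightarrow> 'c::real_normed_vector"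
  assumes lip: "\<And>t y z. t \<in> I \<Longrightarrow> norm (f t y - f t z) \<le> L * norm (y - z)"
    and cont: "\<And>y. continuous_on I (\<lambda>t. f t y)"
    and u: "continuous_on I u"
  shows "continuous_on I (\<lambda>t. f t (u t))"
  unfolding continuous_on_def
proof
  fix t assume t: "t \<in> I"
  have "((\<lambda>s. L * norm (u s - u t) + norm (f s (u t) - f t (u t))) \<longlongrightarrow> L * norm (u t - u t) + norm (f t (u t) - f t (u t))) (at t within I)"
    using u cont[of "u t"] t unfolding continuous_on_def by (intro tendsto_intros) auto
  then have lim: "((\<lambda>s. L * norm (u s - u t) + norm (f s (u t) - f t (u t))) \<longlongrightarrow> 0) (at t within I)"
    by simp
  have ev: "\<forall>\<^sub>F s in at t within I. norm (f s (u s) - f t (u t)) \<le> L * norm (u s - u t) + norm (f s (u t) - f t (u t))"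
    unfolding eventually_at_filter
  proof (intro always_eventually allI impI)
    fix s assume "s \<in> I"
    from lip[OF this, of "u s" "u t"] norm_triangle_ineq[of "f s (u s) - f s (u t)" "f s (u t) - f t (u t)"]
    show "norm (f s (u s) - f t (u t)) \<le> L * norm (u s - u t) + norm (f s (u t) - f t (u t))" by simp
  qed
  have "((\<lambda>s. f s (u s) - f t (u t)) \<longlongrightarrow> 0) (at t within I)"
    by (rule Lim_null_comparison[OF ev lim])
  then show "((\<lambda>s. f s (u s)) \<longlongrightarrow> f t (u t)) (at t within I)"
    using Lim_null by blast
qed

text \<open>Picard iteration is started at the approximate solution \<open>w\<close> instead of a
  constant, so one series yields both existence and the distance to \<open>w\<close>. This takes the
  place of a Gronwall estimate.\<close>

lemma picard_near_approximate_solution: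
  fixes f :: "real \<Rightarrow> 'a::euclidean_space \<Rightarrow> 'a"
  assumes ab: "a \<le> b" and L: "L > 0"
    and lip: "\<And>t y z. t \<in> {a..b} \<Longrightarrow> norm (f t y - f t z) \<le> L * norm (y - z)"
    and cont: "\<And>y. continuous_on {a..b} (\<lambda>t. f t y)"
    and w: "continuous_on {a..b} w"
    and res: "\<And>t. t \<in> {a..b} \<Longrightarrow> norm (w t - (y0 + integral {a..t} (\<lambda>s. f s (w s)))) \<le> \<epsilon>"
  obtains y where "y a = y0"
    "\<And>t. t \<in> {a..b} \<Longrightarrow> (y has_vector_derivative f t (y t)) (at t within {a..b})"
    "\<And>t. t \<in> {a..b} \<Longrightarrow> norm (y t - w t) \<le> 2 * \<epsilon> * exp (2 * L * (b - a))"
proof -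
  define \<Phi> where "\<Phi> u t = y0 + integral {a..t} (\<lambda>s. f s (u s))" for u t
  have comp: "continuous_on {a..b} (\<lambda>t. f t (u t))" if "continuous_on {a..b} u" for u
    by (rule continuous_on_lipschitz_compose[OF lip cont that])
  have sub: "continuous_on {a..t} g" if "continuous_on {a..b} g" "t \<in> {a..b}" for g :: "real \<Rightarrow> 'a" and t
    using that by (meson atLeastAtMost_iff atLeastatMost_subset_iff continuous_on_subset order_refl)
  have \<Phi>cont: "continuous_on {a..b} (\<Phi> u)" if "continuous_on {a..b} u" for u
    unfolding \<Phi>_def using comp[OF that]
    by (intro continuous_intros indefinite_integral_continuous_1 integrable_continuous_real)
  \<comment> \<open>The exponential weight makes \<Phi> halve distances on the whole interval,
    whatever its length: integrating \<open>L * (B * exp (2 * L * (s - a)))\<close> produces the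
    factor \<open>B / 2\<close>.\<close>
  have contr: "norm (\<Phi> u t - \<Phi> v t) \<le> B / 2 * exp (2 * L * (t - a))"
    if u: "continuous_on {a..b} u" and v: "continuous_on {a..b} v" and t: "t \<in> {a..b}"
      and B: "\<And>s. s \<in> {a..b} \<Longrightarrow> norm (u s - v s) \<le> B * exp (2 * L * (s - a))" for u v t B
  proof -
    have "norm (u a - v a) \<le> B" using B[of a] ab by simp
    then have B0: "B \<ge> 0" using norm_ge_zero order_trans by blast
    have iu: "(\<lambda>s. f s (u s)) integrable_on {a..t}" and iv: "(\<lambda>s. f s (v s)) integrable_on {a..t}"
      using sub[OF comp t] u v integrable_continuous_real by blast+
    have E: "((\<lambda>s. L * (B * exp (2 * L * (s - a)))) has_integral (B / 2 * exp (2 * L * (t - a)) - B / 2 * exp (2 * L * (a - a)))) {a..t}"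
      using t L by (intro fundamental_theorem_of_calculus)
        (auto intro!: derivative_eq_intros simp flip: has_real_derivative_iff_has_vector_derivative)
    have "norm (\<Phi> u t - \<Phi> v t) = norm (integral {a..t} (\<lambda>s. f s (u s) - f s (v s)))"
      using iu iv by (simp add: \<Phi>_def integral_diff)
    also have "\<dots> \<le> integral {a..t} (\<lambda>s. L * (B * exp (2 * L * (s - a))))"
    proof (rule integral_norm_bound_integral)
      fix s assume "s \<in> {a..t}"
      then have s: "s \<in> {a..b}" using t by auto
      show "norm (f s (u s) - f s (v s)) \<le> L * (B * exp (2 * L * (s - a)))"
        using lip[OF s, of "u s" "v s"] mult_left_mono[OF B[OF s], of L] L by linarith
    qed (use iu iv E in \<open>auto intro: integrable_diff\<close>)
    also have "\<dots> \<le> B / 2 * exp (2 * L * (t - a))"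
      using B0 by (simp only: integral_unique[OF E]) simp
    finally show ?thesis .
  qed
  define u where "u n = (\<Phi> ^^ n) w" for n
  have u0: "u 0 = w" and uS: "u (Suc n) = \<Phi> (u n)" for n by (simp_all add: u_def)
  have ucont: "continuous_on {a..b} (u n)" for n
    by (induction n) (auto simp: u0 uS w \<Phi>cont)
  have step: "norm (u (Suc n) t - u n t) \<le> \<epsilon> * (1/2)^n * exp (2 * L * (t - a))" if "t \<in> {a..b}" for n t
    using that
  proof (induction n arbitrary: t)
    case 0
    have e: "\<epsilon> \<ge> 0" using res[OF 0] norm_ge_zero order_trans by blast
    have "1 \<le> exp (2 * L * (t - a))" using 0 L by simp
    from mult_left_mono[OF this e] res[OF 0] show ?case 
      by (simp add: uS u0 \<Phi>_def norm_minus_commute)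
  next
    case (Suc n)
    have "norm (\<Phi> (u (Suc n)) t - \<Phi> (u n) t) \<le> \<epsilon> * (1/2)^n / 2 * exp (2 * L * (t - a))"
      by (rule contr) (use Suc ucont in auto)
    then show ?case by (simp add: uS)
  qed
  \<comment> \<open>Weierstrass majorant, uniform in \<open>t\<close>; its geometric series with
    ratio 1/2 is the source of the factor 2 in the distance bound.\<close>
  define M where "M n = \<epsilon> * exp (2 * L * (b - a)) * (1/2)^n" for n :: nat
  have eps: "\<epsilon> \<ge> 0" using res[of a] ab norm_ge_zero order_trans by (metis atLeastAtMost_iff order_refl)
  have stepM: "norm (u (Suc n) t - u n t) \<le> M n" if t: "t \<in> {a..b}" for n t
  proof -
    have "exp (2 * L * (t - a)) \<le> exp (2 * L * (b - a))" using t L by simp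
    from mult_left_mono[OF this, of "\<epsilon> * (1/2)^n"] step[OF t, of n] eps show ?thesis
      by (simp add: M_def mult_ac)
  qed
  have "M sums (\<epsilon> * exp (2 * L * (b - a)) * (1 / (1 - 1/2)))"
    unfolding M_def by (intro sums_mult geometric_sums) simp
  then have M: "summable M" "suminf M = 2 * \<epsilon> * exp (2 * L * (b - a))"
    by (auto simp: sums_iff)
  define y where "y t = w t + (\<Sum>i. u (Suc i) t - u i t)" for t
  have "uniform_limit {a..b} (\<lambda>n t. \<Sum>i<n. u (Suc i) t - u i t) (\<lambda>t. \<Sum>i. u (Suc i) t - u i t) sequentially"
    by (rule Weierstrass_m_test[OF stepM M(1)])
  then have "uniform_limit {a..b} (\<lambda>n t. w t + (\<Sum>i<n. u (Suc i) t - u i t)) y sequentially"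
    unfolding y_def by (intro uniform_limit_add uniform_limit_const)
  moreover have tel: "w t + (\<Sum>i<n. u (Suc i) t - u i t) = u n t" for n t
    by (simp add: sum_lessThan_telescope[where f="\<lambda>i. u i t"] u0)
  ultimately have unif: "uniform_limit {a..b} u y sequentially" by simp
  have ycont: "continuous_on {a..b} y"
    by (rule uniform_limit_theorem[OF _ unif]) (auto simp: ucont)
  have ylim: "(\<lambda>n. u n t) \<longlonglongrightarrow> y t" if "t \<in> {a..b}" for t
    using tendsto_uniform_limitI[OF unif that] .
  have fix_pt: "y t = \<Phi> y t" if t: "t \<in> {a..b}" for t
  proof -
    have "(\<lambda>n. \<Phi> (u n) t) \<longlonglongrightarrow> \<Phi> y t"
      unfolding tendsto_iff
    proof (intro allI impI)
      fix e :: real assume "e > 0"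
      \<comment> \<open>Scaled so that after the contraction the weighted bound at \<open>b\<close>
        is still \<open>e / 2\<close>.\<close>
      define e' where "e' = e / exp (2 * L * (b - a))"
      have "e' > 0" using \<open>e > 0\<close> by (simp add: e'_def)
      from uniform_limitD[OF unif this]
      show "\<forall>\<^sub>F n in sequentially. dist (\<Phi> (u n) t) (\<Phi> y t) < e"
      proof eventually_elim
        case (elim n)
        have "norm (\<Phi> (u n) t - \<Phi> y t) \<le> e' / 2 * exp (2 * L * (t - a))"
        proof (rule contr[OF ucont ycont t])
          fix s assume s: "s \<in> {a..b}"
          have "1 \<le> exp (2 * L * (s - a))" using s L by simp
          from mult_left_mono[OF this, of e'] \<open>e' > 0\<close>
          have "e' \<le> e' * exp (2 * L * (s - a))" by simp
          moreover have "norm (u n s - y s) < e'" using elim s by (simp add: dist_norm)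
          ultimately show "norm (u n s - y s) \<le> e' * exp (2 * L * (s - a))" by linarith
        qed
        also have "\<dots> \<le> e' / 2 * exp (2 * L * (b - a))" using t L \<open>e' > 0\<close> by simp
        also have "\<dots> < e" using \<open>e > 0\<close> by (simp add: e'_def)
        finally show ?case by (simp add: dist_norm)
      qed
    qed
    moreover have "(\<lambda>n. \<Phi> (u n) t) \<longlonglongrightarrow> y t"
      using LIMSEQ_Suc[OF ylim[OF t]] by (simp add: uS)
    ultimately show ?thesis using LIMSEQ_unique by blast
  qed
  show thesis
  proof
    show "y a = y0" using fix_pt[of a] ab by (simp add: \<Phi>_def)
    fix t assume t: "t \<in> {a..b}"
    have "((\<lambda>t. y0 + integral {a..t} (\<lambda>s. f s (y s))) has_vector_derivative f t (y t)) (at t within {a..b})"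
      using integral_has_vector_derivative[OF comp[OF ycont] t]
      by (auto intro!: derivative_eq_intros)
    then show "(y has_vector_derivative f t (y t)) (at t within {a..b})"
      by (rule has_vector_derivative_transform[rotated 2]) (use t fix_pt in \<open>auto simp: \<Phi>_def\<close>)
    have "norm (u n t - w t) \<le> 2 * \<epsilon> * exp (2 * L * (b - a))" for n
    proof -
      have "norm (u n t - w t) \<le> (\<Sum>i<n. M i)"
        unfolding tel[symmetric, of n t] using stepM[OF t] by (simp add: sum_norm_le)
      also have "\<dots> \<le> suminf M" using M(1) eps by (intro sum_le_suminf) (auto simp: M_def)
      finally show ?thesis using M(2) by simp
    qed
    then show "norm (y t - w t) \<le> 2 * \<epsilon> * exp (2 * L * (b - a))"
      using ylim[OF t] by (intro Lim_bounded[of "\<lambda>n. norm (u n t - w t)"]) (auto intro!: tendsto_intros)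
  qed
qed

section \<open>Clarke gradients of semiconvex functions\<close>

text \<open>The excess \<phi> over the chord vanishes at both ends and attains a maximum at some
  \<open>m\<close>. This \<open>m\<close> is the midpoint of its nearer endpoint and another point
  of the interval, so midpoint convexity bounds the maximum by half of itself, and it cannot be
  positive.\<close>

lemma midpoint_convex_imp_convex_on:
  fixes g :: "'a::real_normed_vector \<Rightarrow> real"
  assumes cont: "continuous_on UNIV g"
    and mid: "\<And>x y. g ((1/2) *\<^sub>R (x + y)) \<le> (g x + g y) / 2"
  shows "convex_on UNIV g"
proof (rule convex_onI)
  fix t :: real and x y :: 'a assume t: "0 < t" "t < 1"
  define \<phi> where "\<phi> s = g ((1 - s) *\<^sub>R x + s *\<^sub>R y) - ((1 - s) * g x + s * g y)" for s
  have "continuous_on {0..1} \<phi>"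
    unfolding \<phi>_def by (intro continuous_intros continuous_on_compose2[OF cont]) auto
  then obtain m where m: "m \<in> {0..1}" "\<And>s. s \<in> {0..1} \<Longrightarrow> \<phi> s \<le> \<phi> m"
    using continuous_attains_sup[of "{0..1::real}" \<phi>] by auto
  have \<phi>mid: "\<phi> ((r + s) / 2) \<le> (\<phi> r + \<phi> s) / 2" for r s
  proof -
    have "(1 - (r + s) / 2) *\<^sub>R x + ((r + s) / 2) *\<^sub>R y
        = (1/2) *\<^sub>R (((1 - r) *\<^sub>R x + r *\<^sub>R y) + ((1 - s) *\<^sub>R x + s *\<^sub>R y))"
      by (simp add: algebra_simps add_divide_distrib diff_divide_distrib)
        (simp flip: scaleR_add_left)
    with mid[of "(1 - r) *\<^sub>R x + r *\<^sub>R y" "(1 - s) *\<^sub>R x + s *\<^sub>R y"] 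
    have "g ((1 - (r + s) / 2) *\<^sub>R x + ((r + s) / 2) *\<^sub>R y)
        \<le> (g ((1 - r) *\<^sub>R x + r *\<^sub>R y) + g ((1 - s) *\<^sub>R x + s *\<^sub>R y)) / 2" by (simp only:)
    moreover have "(1 - (r + s) / 2) * g x + (r + s) / 2 * g y
        = (((1 - r) * g x + r * g y) + ((1 - s) * g x + s * g y)) / 2" by (simp add: field_simps)
    ultimately show ?thesis unfolding \<phi>_def by (simp only: diff_divide_distrib add_divide_distrib)
  qed
  have ends: "\<phi> 0 = 0" "\<phi> 1 = 0" by (auto simp: \<phi>_def)
  have "\<phi> m \<le> 0"
  proof (cases "m \<le> 1/2")
    case True
    then show ?thesis using \<phi>mid[of 0 "2 * m"] m(2)[of "2 * m"] m(1) ends by auto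
  next
    case False
    then show ?thesis using \<phi>mid[of 1 "2 * m - 1"] m(2)[of "2 * m - 1"] m(1) ends by auto
  qed
  with m(2)[of t] t have "\<phi> t \<le> 0" by simp
  then show "g ((1 - t) *\<^sub>R x + t *\<^sub>R y) \<le> (1 - t) * g x + t * g y" by (simp add: \<phi>_def)
qed simp

text \<open>By the parallelogram identity the midpoint gain of \<open>c * (norm x)\<^sup>2\<close>
  is \<open>c / 4 * (norm (x - y))\<^sup>2\<close>, exactly the error that
  \<open>semiconvex_with\<close> allows.\<close>

lemma semiconvex_with_imp_convex_on:
  fixes h :: "'a::real_inner \<Rightarrow> real"
  assumes "semiconvex_with c h"
  shows "convex_on UNIV (\<lambda>x. h x + c * (norm x)\<^sup>2)"
proof (rule midpoint_convex_imp_convex_on)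
  have "continuous_on UNIV h"
    using continuous_on_minus[OF conjunct1[OF assms[unfolded semiconvex_with_def]]] by simp
  then show "continuous_on UNIV (\<lambda>x. h x + c * (norm x)\<^sup>2)" by (intro continuous_intros) auto
  fix x y
  have "(- h x - h y) / 2 + h ((1/2) *\<^sub>R (x + y)) \<le> c / 4 * (norm (x - y))\<^sup>2"
    using assms unfolding semiconvex_with_def by blast
  moreover have "(norm ((1/2) *\<^sub>R (x + y)))\<^sup>2 = ((norm x)\<^sup>2 + (norm y)\<^sup>2) / 2 - (norm (x - y))\<^sup>2 / 4"
    by (simp add: power2_norm_eq_inner inner_simps inner_commute field_simps)
  then have "c * (norm ((1/2) *\<^sub>R (x + y)))\<^sup>2 = c * (((norm x)\<^sup>2 + (norm y)\<^sup>2) / 2 - (norm (x - y))\<^sup>2 / 4)"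
    by (simp only:)
  then have "c * (norm ((1/2) *\<^sub>R (x + y)))\<^sup>2 = (c * (norm x)\<^sup>2 + c * (norm y)\<^sup>2) / 2 - c / 4 * (norm (x - y))\<^sup>2"
    by (simp only: right_diff_distrib distrib_left times_divide_eq_right times_divide_eq_left mult.commute)
  ultimately show "h ((1/2) *\<^sub>R (x + y)) + c * (norm ((1/2) *\<^sub>R (x + y)))\<^sup>2
      \<le> (h x + c * (norm x)\<^sup>2 + (h y + c * (norm y)\<^sup>2)) / 2"
    by (simp add: add_divide_distrib diff_divide_distrib) 
qed

text \<open>A Clarke gradient is defined by limits, but for a semiconvex function it gives a global
  lower quadratic bound. Convexity of \<open>g\<close> bounds difference quotients with step below 1
  by a full increment of \<open>g\<close>, and this bound is continuous in base point and step, so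
  it survives the limsup.\<close>

lemma clarke_grad_semiconvex:
  fixes h :: "'a::euclidean_space \<Rightarrow> real"
  assumes sc: "semiconvex_with c h" and \<zeta>: "\<zeta> \<in> clarke_grad h x"
  shows "h x + \<zeta> \<bullet> v - c * (norm v)\<^sup>2 \<le> h (x + v)"
proof -
  define g where "g x = h x + c * (norm x)\<^sup>2" for x
  have g: "convex_on UNIV g" using semiconvex_with_imp_convex_on[OF sc] by (simp add: g_def[abs_def])
  have "continuous_on UNIV h"
    using continuous_on_minus[OF conjunct1[OF sc[unfolded semiconvex_with_def]]] by simp
  then have gcont: "continuous_on UNIV g" unfolding g_def by (intro continuous_intros) auto
  \<comment> \<open>Continuous majorant of the difference quotient of \<open>h\<close> at base point
    \<open>fst z\<close> and step \<open>snd z\<close>; the subtracted term is the exact quotient of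
    the added quadratic.\<close>
  define G where "G z = g (fst z + v) - g (fst z) - c * (2 * (fst z \<bullet> v) + snd z * (norm v)\<^sup>2)" for z :: "'a \<times> real"
  have "continuous_on UNIV G"
    unfolding G_def by (intro continuous_intros continuous_on_compose2[OF gcont]) auto
  then have lim: "(G \<longlongrightarrow> G (x, 0)) (at (x, 0) within (UNIV \<times> {0<..}))"
    by (meson UNIV_I continuous_on_def filterlim_mono order_refl at_le subset_UNIV)
  have G0: "G (x, 0) = h (x + v) - h x + c * (norm v)\<^sup>2"
    by (simp add: G_def g_def power2_norm_eq_inner algebra_simps inner_commute)
  have "\<zeta> \<bullet> v \<le> G (x, 0) + e" if "e > 0" for e
  proof -
    have "\<forall>\<^sub>F z in at (x, 0) within (UNIV \<times> {0<..}). G z < G (x, 0) + e"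
      by (rule order_tendstoD(2)[OF lim]) (use that in simp)
    moreover have "\<forall>\<^sub>F z in at (x, 0::real) within (UNIV \<times> {0<..}). snd z < 1"
      by (rule order_tendstoD(2)[of snd 0]) (auto intro!: tendsto_eq_intros)
    moreover have "\<forall>\<^sub>F z in at (x, 0::real) within (UNIV \<times> {0<..}). snd z > 0"
      unfolding eventually_at_filter by (intro always_eventually) (auto simp: mem_Times_iff)
    ultimately have "\<forall>\<^sub>F z in at (x, 0) within (UNIV \<times> {0<..}).
        (case z of (y, t) \<Rightarrow> ereal ((h (y + t *\<^sub>R v) - h y) / t)) \<le> ereal (G (x, 0) + e)"
    proof eventually_elim
      case (elim z)
      obtain y t where z: "z = (y, t)" by (cases z)
      have t: "0 < t" "t < 1" using elim z by auto
      have "g ((1 - t) *\<^sub>R y + t *\<^sub>R (y + v)) \<le> (1 - t) * g y + t * g (y + v)"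
        using convex_onD[OF g, of t y "y + v"] t by auto
      also have "(1 - t) *\<^sub>R y + t *\<^sub>R (y + v) = y + t *\<^sub>R v" by (simp add: algebra_simps)
      finally have "h (y + t *\<^sub>R v) - h y \<le> t * (g (y + v) - g y) - c * ((norm (y + t *\<^sub>R v))\<^sup>2 - (norm y)\<^sup>2)"
        by (simp add: g_def[of y] g_def[of "y + t *\<^sub>R v"] algebra_simps)
      also have "(norm (y + t *\<^sub>R v))\<^sup>2 - (norm y)\<^sup>2 = t * (2 * (y \<bullet> v) + t * (norm v)\<^sup>2)"
        by (simp add: power2_norm_eq_inner algebra_simps inner_commute)
      also have "t * (g (y + v) - g y) - c * (t * (2 * (y \<bullet> v) + t * (norm v)\<^sup>2)) = t * G z"
        by (simp add: G_def z algebra_simps)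
      finally have "(h (y + t *\<^sub>R v) - h y) / t \<le> G z" using t by (simp add: field_simps)
      then show ?case using elim z by auto
    qed
    then have "clarke_dd h x v \<le> ereal (G (x, 0) + e)"
      unfolding clarke_dd_def by (rule Limsup_bounded)
    moreover have "ereal (\<zeta> \<bullet> v) \<le> clarke_dd h x v" using \<zeta> by (simp add: clarke_grad_def)
    ultimately show ?thesis using order_trans by fastforce
  qed
  then have "\<zeta> \<bullet> v \<le> G (x, 0)" by (meson field_le_epsilon)
  then show ?thesis using G0 by simp
qed

section \<open>The Hamiltonian and its gradient\<close>

lemma bdd_above_inner_compact:
  fixes A :: "'a::euclidean_space set"
  assumes "compact A"
  shows "bdd_above ((\<lambda>v. q \<bullet> v) ` A)"
  by (intro bounded_imp_bdd_above compact_imp_bounded compact_continuous_image continuous_intros assms)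

lemma inner_le_Ham:
  assumes "compact (F y)" "v \<in> F y"
  shows "q \<bullet> v \<le> Ham F y q"
  unfolding Ham_def by (rule cSUP_upper[OF assms(2) bdd_above_inner_compact[OF assms(1)]])

lemma Ham_attained:
  assumes "compact (F y)" "F y \<noteq> {}"
  obtains v where "v \<in> F y" "Ham F y q = q \<bullet> v"
proof -
  have "continuous_on (F y) (\<lambda>v. q \<bullet> v)" by (intro continuous_intros)
  from continuous_attains_sup[OF assms this]
  obtain v where v: "v \<in> F y" "\<And>w. w \<in> F y \<Longrightarrow> q \<bullet> w \<le> q \<bullet> v" by blast
  have "Ham F y q \<le> q \<bullet> v" unfolding Ham_def using v assms(2) by (intro cSUP_least) auto
  with inner_le_Ham[where F=F and y=y and q=q, OF assms(1) v(1)] v(1) that show thesis by (metis antisym)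
qed

lemma Ham_scaleR:
  assumes "compact (F y)" "F y \<noteq> {}" "c \<ge> 0"
  shows "Ham F y (c *\<^sub>R q) = c * Ham F y q"
proof (rule antisym)
  obtain v where v: "v \<in> F y" "Ham F y (c *\<^sub>R q) = (c *\<^sub>R q) \<bullet> v"
    using Ham_attained[where F=F and y=y, OF assms(1,2)] .
  then show "Ham F y (c *\<^sub>R q) \<le> c * Ham F y q"
    using mult_left_mono[OF inner_le_Ham[where F=F and y=y and q=q, OF assms(1) v(1)] assms(3)] by simp
  obtain w where w: "w \<in> F y" "Ham F y q = q \<bullet> w"
    using Ham_attained[where F=F and y=y, OF assms(1,2)] .
  then show "c * Ham F y q \<le> Ham F y (c *\<^sub>R q)"
    using inner_le_Ham[where F=F and y=y and q="c *\<^sub>R q", OF assms(1) w(1)] by simp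
qed

lemma Ham_lipschitz:
  assumes "compact (F y)" "F y \<noteq> {}" "compact (F z)" 
    and lip: "\<forall>v\<in>F y. \<exists>w\<in>F z. norm (v - w) \<le> k"
  shows "Ham F y q \<le> Ham F z q + norm q * k"
proof -
  obtain v where v: "v \<in> F y" "Ham F y q = q \<bullet> v" using Ham_attained[where F=F and y=y, OF assms(1,2)] .
  obtain w where w: "w \<in> F z" "norm (v - w) \<le> k" using lip v(1) by blast
  have "q \<bullet> v = q \<bullet> w + q \<bullet> (v - w)" by (simp add: inner_diff_right)
  also have "q \<bullet> (v - w) \<le> norm q * k"
    using norm_cauchy_schwarz[of q "v - w"] mult_left_mono[OF w(2), of "norm q"] by simp
  finally show ?thesis using v(2) inner_le_Ham[where F=F and y=z and q=q, OF assms(3) w(1)] by simp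
qed

text \<open>Danskin: \<open>r \<mapsto> H(y,r) - \<langle>r,v\<rangle>\<close> is nonnegative and vanishes at \<open>q\<close>, so its gradient there is zero.\<close>

lemma Fp_eqI:
  fixes F :: "'a::euclidean_space \<Rightarrow> 'a set"
  assumes cpt: "compact (F y)"
    and der: "\<exists>g. ((\<lambda>r. Ham F y r) has_derivative (\<lambda>r. g \<bullet> r)) (at q)"
    and v: "v \<in> F y" "q \<bullet> v = Ham F y q"
  shows "Fp F q y = v"
proof -
  have eq: "g = v" if g: "((\<lambda>r. Ham F y r) has_derivative (\<lambda>r. g \<bullet> r)) (at q)" for g
  proof -
    have "((\<lambda>r. Ham F y r - r \<bullet> v) has_derivative (\<lambda>r. g \<bullet> r - r \<bullet> v)) (at q)"
      by (intro derivative_intros g)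
    then have "(\<lambda>r. g \<bullet> r - r \<bullet> v) = (\<lambda>r. 0)"
      by (rule differential_zero_maxmin[of q UNIV, rotated 2])
         (use inner_le_Ham[where F=F and y=y, OF cpt v(1)] v(2) in auto)
    then have "g \<bullet> (g - v) - (g - v) \<bullet> v = 0" by meson
    then have "(g - v) \<bullet> (g - v) = 0" by (simp add: inner_diff_left inner_diff_right inner_commute)
    then show ?thesis by simp
  qed
  show ?thesis unfolding Fp_def
    by (rule the_equality) (use der eq in auto)
qed

lemma
  fixes F :: "'a::euclidean_space \<Rightarrow> 'a set"
  assumes "compact (F y)" "F y \<noteq> {}"
    and "\<exists>g. ((\<lambda>r. Ham F y r) has_derivative (\<lambda>r. g \<bullet> r)) (at q)"
  shows Fp_in: "Fp F q y \<in> F y" and inner_Fp: "q \<bullet> Fp F q y = Ham F y q"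
proof -
  obtain v where v: "v \<in> F y" "Ham F y q = q \<bullet> v" using Ham_attained[where F=F and y=y, OF assms(1,2)] .
  with Fp_eqI[where F=F and y=y and v=v, OF assms(1,3)] have "Fp F q y = v" by simp
  with v show "Fp F q y \<in> F y" "q \<bullet> Fp F q y = Ham F y q" by auto
qed

text \<open>The maximizer of \<open>q\<close> over \<open>F y\<close> is unique by
  \<open>Fp_eqI\<close>, so the graph of \<open>Fp\<close> is the zero set of the continuous
  function \<open>q \<bullet> v - Ham F y q\<close> on \<open>A \<times> F y\<close>. A closed graph
  with compact target gives continuity.\<close>

lemma continuous_on_Fp:
  fixes F :: "'a::euclidean_space \<Rightarrow> 'a set"
  assumes cpt: "compact (F y)" and ne: "F y \<noteq> {}"
    and der: "\<And>q. q \<in> A \<Longrightarrow> \<exists>g. ((\<lambda>r. Ham F y r) has_derivative (\<lambda>r. g \<bullet> r)) (at q)"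
  shows "continuous_on A (\<lambda>q. Fp F q y)"
proof -
  have H: "continuous_on A (Ham F y)"
    using der has_derivative_continuous continuous_at_imp_continuous_on by blast
  have F: "Fp F q y \<in> F y" "q \<bullet> Fp F q y = Ham F y q" if "q \<in> A" for q
    using Fp_in[where F=F and y=y, OF cpt ne der[OF that]] inner_Fp[where F=F and y=y, OF cpt ne der[OF that]] by auto
  have "continuous_on (A \<times> F y) (\<lambda>z. Ham F y (fst z))"
    by (rule continuous_on_compose2[OF H]) (auto intro: continuous_intros)
  then have "continuous_on (A \<times> F y) (\<lambda>z. fst z \<bullet> snd z - Ham F y (fst z))"
    by (intro continuous_intros)
  then have "closedin (top_of_set (A \<times> F y)) {z \<in> A \<times> F y. fst z \<bullet> snd z - Ham F y (fst z) = 0}"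
    by (rule continuous_closedin_preimage_constant)
  also have "{z \<in> A \<times> F y. fst z \<bullet> snd z - Ham F y (fst z) = 0} = (\<lambda>q. (q, Fp F q y)) ` A"
  proof safe
    fix q v assume "q \<in> A" "v \<in> F y" "fst (q, v) \<bullet> snd (q, v) - Ham F y (fst (q, v)) = 0"
    then have "v = Fp F q y" using Fp_eqI[where F=F and y=y, OF cpt der] by simp
    with \<open>q \<in> A\<close> show "(q, v) \<in> (\<lambda>q. (q, Fp F q y)) ` A" by blast
  qed (use F in auto)
  finally show ?thesis
    using continuous_closed_graph_eq[OF cpt, of "\<lambda>q. Fp F q y" A] F(1) by blast
qed

section \<open>Trajectories and the minimum time function\<close>

lemma has_vector_derivative_shift_within:
  fixes f :: "real \<Rightarrow> 'a::real_normed_vector"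
  assumes "(f has_vector_derivative v) (at (s + c) within I)" "\<And>t. t \<in> J \<Longrightarrow> t + c \<in> I"
  shows "((\<lambda>t. f (t + c)) has_vector_derivative v) (at s within J)"
proof -
  have "(f has_vector_derivative v) (at (s + c) within (\<lambda>t. t + c) ` J)"
    by (rule has_vector_derivative_within_subset[OF assms(1)]) (use assms(2) in auto)
  moreover have "((\<lambda>t. t + c) has_vector_derivative 1) (at s within J)"
    by (auto intro!: derivative_eq_intros)
  ultimately show ?thesis
    using vector_diff_chain_within[of "\<lambda>t. t + c" 1 s J f v] by (simp add: o_def)
qed

lemma negligible_shift:
  fixes N :: "real set"
  assumes "negligible N"
  shows "negligible {t. t + c \<in> N}"
proof -
  have "{t. t + c \<in> N} = (+) (- c) ` N" by (force simp: image_iff)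
  then show ?thesis using negligible_translation[OF assms, of "- c"] by (simp only:)
qed

lemma trajectory_on_restrict:
  assumes y: "trajectory_on F \<tau> y" and s: "s \<le> \<tau>"
  shows "trajectory_on F s y"
proof -
  have sub: "{0..s} \<subseteq> {0..\<tau>}" using s by auto
  obtain N where N: "negligible N" "\<And>t. t \<in> {0..\<tau>} - N \<Longrightarrow> \<exists>v. (y has_vector_derivative v) (at t within {0..\<tau>}) \<and> v \<in> F (y t)"
    using y unfolding trajectory_on_def by blast
  have "\<exists>v. (y has_vector_derivative v) (at t within {0..s}) \<and> v \<in> F (y t)" if "t \<in> {0..s} - N" for t
    using N(2)[of t] that sub has_vector_derivative_within_subset by blast
  with y N(1) show ?thesis
    unfolding trajectory_on_def using abs_cont_on_subset[OF _ sub] by blast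
qed

lemma trajectory_on_shift:
  assumes y: "trajectory_on F \<tau> y" and s: "0 \<le> s"
  shows "trajectory_on F (\<tau> - s) (\<lambda>t. y (t + s))"
proof -
  have sub: "t + s \<in> {0..\<tau>}" if "t \<in> {0..\<tau> - s}" for t using s that by auto
  obtain N where N: "negligible N" "\<And>t. t \<in> {0..\<tau>} - N \<Longrightarrow> \<exists>v. (y has_vector_derivative v) (at t within {0..\<tau>}) \<and> v \<in> F (y t)"
    using y unfolding trajectory_on_def by blast
  have "\<exists>v. ((\<lambda>t. y (t + s)) has_vector_derivative v) (at t within {0..\<tau> - s}) \<and> v \<in> F (y (t + s))"
    if "t \<in> {0..\<tau> - s} - {t. t + s \<in> N}" for t
    using N(2)[of "t + s"] that sub has_vector_derivative_shift_within[OF _ sub] by blast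
  with y show ?thesis
    unfolding trajectory_on_def using abs_cont_on_shift[OF _ sub] negligible_shift[OF N(1), of s] by blast
qed

lemma trajectory_on_concat:
  assumes y1: "trajectory_on F s y1" and y2: "trajectory_on F \<tau> y2"
    and eq: "y1 s = y2 0" and s: "0 \<le> s" and \<tau>: "0 \<le> \<tau>"
  shows "trajectory_on F (s + \<tau>) (\<lambda>t. if t \<le> s then y1 t else y2 (t - s))" (is "trajectory_on F _ ?y")
proof -
  obtain N1 where N1: "negligible N1" "\<And>t. t \<in> {0..s} - N1 \<Longrightarrow> \<exists>v. (y1 has_vector_derivative v) (at t within {0..s}) \<and> v \<in> F (y1 t)"
    using y1 unfolding trajectory_on_def by blast
  obtain N2 where N2: "negligible N2" "\<And>t. t \<in> {0..\<tau>} - N2 \<Longrightarrow> \<exists>v. (y2 has_vector_derivative v) (at t within {0..\<tau>}) \<and> v \<in> F (y2 t)"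
    using y2 unfolding trajectory_on_def by blast
  have left: "?y t = y1 t" if "t \<in> {0..s}" for t using that by simp
  have right: "?y t = y2 (t + - s)" if "t \<in> {s..s + \<tau>}" for t using that eq by (cases "t = s") auto
  have sh: "t + - s \<in> {0..\<tau>}" if "t \<in> {s..s + \<tau>}" for t using that by auto
  have ac: "abs_cont_on {0..s + \<tau>} ?y"
  proof (rule abs_cont_on_join[OF _ _ s])
    have "abs_cont_on {0..s} y1" using y1 by (simp add: trajectory_on_def)
    then show "abs_cont_on {0..s} ?y"
      by (rule abs_cont_on_dominated[where g=y1 and B=1 and C=0]) (use \<open>abs_cont_on {0..s} y1\<close> in auto)
    have ac2: "abs_cont_on {s..s + \<tau>} (\<lambda>t. y2 (t + - s))"
      by (rule abs_cont_on_shift[OF _ sh]) (use y2 in \<open>simp add: trajectory_on_def\<close>)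
    show "abs_cont_on {s..s + \<tau>} ?y"
    proof (rule abs_cont_on_dominated[OF ac2 ac2, where B=1 and C=0])
      fix r t assume "r \<in> {s..s + \<tau>}" "t \<in> {s..s + \<tau>}"
      then show "norm (?y t - ?y r) \<le> 1 * norm (y2 (t + - s) - y2 (r + - s)) + 0 * norm (y2 (t + - s) - y2 (r + - s))"
        by (simp only: right)
    qed
  qed (use \<tau> in auto)
  \<comment> \<open>The junction time \<open>s\<close> joins the exceptional set, since the
    one-sided derivatives there may differ. Away from it, the derivative within a piece is the
    derivative within the whole interval.\<close>
  have "\<exists>v. (?y has_vector_derivative v) (at t within {0..s + \<tau>}) \<and> v \<in> F (?y t)"
    if t: "t \<in> {0..s + \<tau>} - (N1 \<union> {t. t + - s \<in> N2} \<union> {s})" for t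
  proof (cases "t < s")
    case True
    then have ts: "t \<in> {0..s}" "t \<notin> N1" using t by auto
    then obtain v where v: "(y1 has_vector_derivative v) (at t within {0..s})" "v \<in> F (y1 t)"
      using N1(2) by blast
    have "(?y has_vector_derivative v) (at t within {0..s})"
      by (rule has_vector_derivative_transform[OF ts(1) left v(1)])
    moreover have "at t within {0..s} = at t within {0..s + \<tau>}"
      by (rule at_within_nhd[of _ "{..<s}"]) (use True \<tau> in auto)
    ultimately show ?thesis using v(2) True by auto
  next
    case False
    then have ts: "t \<in> {s..s + \<tau>}" "t + - s \<notin> N2" "s < t" using t by auto
    then obtain v where v: "(y2 has_vector_derivative v) (at (t + - s) within {0..\<tau>})" "v \<in> F (y2 (t + - s))"
      using N2(2) sh by blast
    have "(?y has_vector_derivative v) (at t within {s..s + \<tau>})"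
      by (rule has_vector_derivative_transform[OF ts(1) right has_vector_derivative_shift_within[OF v(1) sh]])
    moreover have "at t within {s..s + \<tau>} = at t within {0..s + \<tau>}"
      by (rule at_within_nhd[of _ "{s<..}"]) (use ts s in auto)
    ultimately show ?thesis using v(2) ts by auto
  qed
  moreover have "negligible (N1 \<union> {t. t + - s \<in> N2} \<union> {s})"
    using N1(1) negligible_shift[OF N2(1), of "- s"] by simp
  ultimately show ?thesis using ac unfolding trajectory_on_def by blast
qed

lemma min_time_le:
  assumes "\<tau> > 0" "trajectory_on F \<tau> y" "y \<tau> \<in> S"
  shows "min_time F S (y 0) \<le> ereal \<tau>"
  unfolding min_time_def using assms by (intro Inf_lower) blast

lemma min_time_nonneg: "min_time F S x \<ge> 0"
  unfolding min_time_def by (intro Inf_greatest) (auto simp: zero_ereal_def)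

text \<open>Dynamic programming: the tail of the optimal arc gives the upper bound, and putting the
  initial piece of \<open>x\<close> in front of any competitor from \<open>x t\<close> gives a
  competitor from \<open>x 0\<close>, hence the lower bound.\<close>

lemma min_time_along_optimal:
  assumes opt: "min_time F S (x 0) = ereal T" and x: "trajectory_on F T x" and reach: "x T \<in> S"
    and t: "0 \<le> t" "t < T"
  shows "min_time F S (x t) = ereal (T - t)"
proof (rule antisym)
  show "min_time F S (x t) \<le> ereal (T - t)"
    using min_time_le[of "T - t" F "\<lambda>s. x (s + t)" S] trajectory_on_shift[OF x t(1)] t reach by simp
  show "ereal (T - t) \<le> min_time F S (x t)"
    unfolding min_time_def
  proof (rule Inf_greatest, safe)
    fix \<tau> y assume \<tau>: "0 < \<tau>" and y: "trajectory_on F \<tau> y" "y 0 = x t" "y \<tau> \<in> S"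
    have "trajectory_on F (t + \<tau>) (\<lambda>s. if s \<le> t then x s else y (s - t))"
      using trajectory_on_restrict[OF x, of t] y t \<tau> by (intro trajectory_on_concat) auto
    from min_time_le[OF _ this, of S] y t \<tau> opt have "ereal T \<le> ereal (t + \<tau>)" by simp
    then show "ereal (T - t) \<le> ereal \<tau>" by simp
  qed
qed

lemma not_in_target_before_optimal_time:
  assumes opt: "min_time F S (x 0) = ereal T" and x: "trajectory_on F T x"
    and t: "0 < t" "t < T"
  shows "x t \<notin> S"
  using min_time_le[OF t(1) trajectory_on_restrict[OF x]] t opt by force

section \<open>Classical solutions as trajectories\<close>

lemma has_vector_derivative_imp_lipschitz:
  fixes y :: "real \<Rightarrow> 'a::euclidean_space"
  assumes der: "\<And>t. t \<in> {a..b} \<Longrightarrow> (y has_vector_derivative v t) (at t within {a..b})"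
    and v: "\<And>t. t \<in> {a..b} \<Longrightarrow> norm (v t) \<le> B"
    and st: "s \<in> {a..b}" "t \<in> {a..b}"
  shows "norm (y t - y s) \<le> B * \<bar>t - s\<bar>"
proof -
  have "norm (y t - y s) \<le> B * norm (t - s)"
  proof (rule differentiable_bound[OF convex_real_interval(5)])
    fix r assume r: "r \<in> {a..b}"
    show "(y has_derivative (\<lambda>h. h *\<^sub>R v r)) (at r within {a..b})"
      using der[OF r] by (simp add: has_vector_derivative_def)
    show "onorm (\<lambda>h. h *\<^sub>R v r) \<le> B"
      by (rule onorm_le) (use v[OF r] in \<open>simp add: mult.commute[of B] mult_left_mono\<close>)
  qed (use st in auto)
  then show ?thesis by simp
qed

text \<open>A continuous velocity on a compact interval is bounded, so the arc is Lipschitz and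
  hence absolutely continuous. The shift by \<open>a\<close> is there because
  \<open>trajectory_on\<close> counts time from 0.\<close>

lemma trajectory_on_C1:
  fixes y :: "real \<Rightarrow> 'a::euclidean_space"
  assumes der: "\<And>t. t \<in> {a..b} \<Longrightarrow> (y has_vector_derivative v t) (at t within {a..b})"
    and cont: "continuous_on {a..b} v" and v: "\<And>t. t \<in> {a..b} \<Longrightarrow> v t \<in> F (y t)" and c: "a + c \<le> b"
  shows "trajectory_on F c (\<lambda>t. y (t + a))"
proof -
  have sub: "t + a \<in> {a..b}" if "t \<in> {0..c}" for t using c that by auto
  have "bounded (v ` {a..b})" by (intro compact_imp_bounded compact_continuous_image cont) simp
  then obtain B where B: "\<And>t. t \<in> {a..b} \<Longrightarrow> norm (v t) \<le> B" unfolding bounded_iff by blast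
  have "abs_cont_on {a..b} y"
    by (rule abs_cont_on_lipschitz) (rule has_vector_derivative_imp_lipschitz[OF der B])
  then have "abs_cont_on {0..c} (\<lambda>t. y (t + a))" by (rule abs_cont_on_shift) (rule sub)
  moreover have "((\<lambda>t. y (t + a)) has_vector_derivative v (t + a)) (at t within {0..c})" if "t \<in> {0..c}" for t
    by (rule has_vector_derivative_shift_within[OF der[OF sub[OF that]] sub])
  ultimately show ?thesis
    unfolding trajectory_on_def using v[OF sub] by (metis DiffD1 negligible_empty)
qed

lemma increment_ge_of_derivative_ge:
  fixes \<phi> :: "real \<Rightarrow> real"
  assumes "a \<le> b" and der: "\<And>t. t \<in> {a..b} \<Longrightarrow> (\<phi> has_vector_derivative \<phi>' t) (at t within {a..b})"
    and ge: "\<And>t. t \<in> {a..b} \<Longrightarrow> m \<le> \<phi>' t"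
  shows "m * (b - a) \<le> \<phi> b - \<phi> a"
  using has_integral_le[OF has_integral_const_real[of m a b] fundamental_theorem_of_calculus[OF assms(1) der] ge] assms(1)
  by (simp add: mult.commute)

text \<open>The proximal inequality is a local condition: at distance at least \<delta> the linear
  Cauchy-Schwarz bound is at most \<open>norm v / \<delta>\<close> times the squared
  distance.\<close>

lemma prox_normal_localI:
  assumes z: "z \<in> Q" and \<delta>: "\<delta> > 0" and C: "C \<ge> 0"
    and loc: "\<And>y. y \<in> Q \<Longrightarrow> norm (y - z) < \<delta> \<Longrightarrow> v \<bullet> (y - z) \<le> C * (norm (y - z))\<^sup>2"
  shows "v \<in> prox_normal Q z"
  unfolding prox_normal_def
proof (safe intro!: z exI[of _ "C + norm v / \<delta>"])
  fix y assume y: "y \<in> Q"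
  show "v \<bullet> (y - z) \<le> (C + norm v / \<delta>) * (norm (y - z))\<^sup>2"
  proof (cases "norm (y - z) < \<delta>")
    case True
    then show ?thesis using loc[OF y] \<delta> by (simp add: distrib_right add_increasing2)
  next
    case False
    have "v \<bullet> (y - z) \<le> norm v * norm (y - z)" by (rule norm_cauchy_schwarz)
    also have "\<dots> = norm v / \<delta> * (\<delta> * norm (y - z))" using \<delta> by simp
    also have "\<dots> \<le> norm v / \<delta> * (norm (y - z) * norm (y - z))"
      using False \<delta> by (intro mult_left_mono mult_right_mono) auto
    also have "\<dots> \<le> (C + norm v / \<delta>) * (norm (y - z))\<^sup>2"
      using C by (simp add: distrib_right power2_eq_square)
    finally show ?thesis .
  qed
qed (use C \<delta> in auto)

lemma prox_normal_scaleR: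
  assumes v: "v \<in> prox_normal Q z" and c: "c \<ge> 0"
  shows "c *\<^sub>R v \<in> prox_normal Q z"
proof -
  obtain \<sigma> where \<sigma>: "\<sigma> \<ge> 0" "\<And>y. y \<in> Q \<Longrightarrow> v \<bullet> (y - z) \<le> \<sigma> * (norm (y - z))\<^sup>2" and z: "z \<in> Q"
    using v unfolding prox_normal_def by blast
  have "(c *\<^sub>R v) \<bullet> (y - z) \<le> c * \<sigma> * (norm (y - z))\<^sup>2" if "y \<in> Q" for y
    using mult_left_mono[OF \<sigma>(2)[OF that] c] by (simp add: mult.assoc)
  moreover have "c * \<sigma> \<ge> 0" using c \<sigma>(1) by simp
  ultimately show ?thesis using z unfolding prox_normal_def by blast
qed

section \<open>Extremal arcs\<close>

locale smooth_hamiltonian =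
  fixes F :: "'a::euclidean_space \<Rightarrow> 'a set" and K c0 K1 :: real
  assumes F_ne: "F y \<noteq> {}"
    and F_compact: "compact (F y)"
    and K_pos: "K > 0"
    and F_lip: "\<forall>v\<in>F x2. \<exists>w\<in>F x1. norm (v - w) \<le> K * norm (x1 - x2)"
    and c0_nonneg: "c0 \<ge> 0"
    and semiconvex: "semiconvex_with (c0 * norm q) (\<lambda>y. Ham F y q)"
    and Ham_diff: "q \<noteq> 0 \<Longrightarrow> \<exists>g. ((\<lambda>r. Ham F y r) has_derivative (\<lambda>r. g \<bullet> r)) (at q)"
    and K1_nonneg: "K1 \<ge> 0"
    and Fp_lip: "q \<noteq> 0 \<Longrightarrow> norm (Fp F q y - Fp F q z) \<le> K1 * norm (y - z)"
begin

lemma Ham_le_Ham: "Ham F y q \<le> Ham F z q + norm q * (K * norm (y - z))"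
  using F_lip[of y z] by (intro Ham_lipschitz F_compact F_ne) (simp add: norm_minus_commute)

lemma Fp_in_F: "q \<noteq> 0 \<Longrightarrow> Fp F q y \<in> F y"
  by (intro Fp_in F_compact F_ne Ham_diff)

lemma inner_Fp_eq: "q \<noteq> 0 \<Longrightarrow> q \<bullet> Fp F q y = Ham F y q"
  by (intro inner_Fp F_compact F_ne Ham_diff)

end

text \<open>The terminal costate is left free, so the normal and the horizontal case share this
  setting. The target set enters only in the individual lemmas.\<close>

locale extremal = smooth_hamiltonian F K c0 K1
  for F :: "'a::euclidean_space \<Rightarrow> 'a set" and K c0 K1 :: real +
  fixes T :: real and x p :: "real \<Rightarrow> 'a"
  assumes T_pos: "T > 0"
    and x_ac: "abs_cont_on {0..T} x" and p_ac: "abs_cont_on {0..T} p"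
    and p_nz: "t \<in> {0..T} \<Longrightarrow> p t \<noteq> 0"
    and adjoint: "\<exists>N. negligible N \<and> (\<forall>t \<in> {0..T} - N.
                 (x has_vector_derivative Fp F (p t) (x t)) (at t within {0..T}) \<and>
                 (\<exists>w. (p has_vector_derivative w) (at t within {0..T}) \<and>
                      - w \<in> clarke_grad (\<lambda>y. Ham F y (p t)) (x t)))"
begin

text \<open>The feedback field of the costate, continued past \<open>T\<close> with the constant costate \<open>p T\<close>.\<close>

definition field :: "real \<Rightarrow> 'a \<Rightarrow> 'a" where
  "field t y = Fp F (p (min t T)) y"

lemma costate_nz: "t \<ge> 0 \<Longrightarrow> p (min t T) \<noteq> 0"
  using T_pos by (intro p_nz) auto

lemma field_in: "t \<ge> 0 \<Longrightarrow> field t y \<in> F y"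
  unfolding field_def by (intro Fp_in_F costate_nz)

lemma field_lip: "t \<ge> 0 \<Longrightarrow> norm (field t y - field t z) \<le> K1 * norm (y - z)"
  unfolding field_def by (intro Fp_lip costate_nz)

lemma field_cont: "continuous_on {0..} (\<lambda>t. field t y)"
proof -
  have c: "continuous_on {0..} (\<lambda>t. p (min t T))"
    using T_pos by (intro continuous_on_compose2[OF abs_cont_on_imp_continuous_on[OF p_ac]] continuous_intros) auto
  have "continuous_on (- {0}) (\<lambda>q. Fp F q y)"
    by (rule continuous_on_Fp[OF F_compact F_ne]) (simp add: Ham_diff)
  moreover have "(\<lambda>t. p (min t T)) ` {0..} \<subseteq> - {0}" using costate_nz by (auto simp: image_subset_iff)
  ultimately show ?thesis unfolding field_def using continuous_on_compose2[OF _ c] by blast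
qed

lemma field_compose_cont:
  assumes "continuous_on {a..b} u" "0 \<le> a"
  shows "continuous_on {a..b} (\<lambda>t. field t (u t))"
  by (rule continuous_on_lipschitz_compose[OF field_lip _ assms(1)])
     (use assms(2) in \<open>auto intro: continuous_on_subset[OF field_cont]\<close>)

section \<open>Regularity of the extremal arc\<close>

lemma x_cont: "continuous_on {0..T} x"
  by (rule abs_cont_on_imp_continuous_on[OF x_ac])

lemma x_integral:
  assumes "0 \<le> s" "s \<le> t" "t \<le> T"
  shows "((\<lambda>r. field r (x r)) has_integral (x t - x s)) {s..t}"
proof -
  obtain N where N: "negligible N" "\<And>t. t \<in> {0..T} - N \<Longrightarrow> (x has_vector_derivative Fp F (p t) (x t)) (at t within {0..T})"
    using adjoint by blast
  show ?thesis
  proof (rule abs_cont_on_fundamental_theorem[OF assms(2) _ N(1)])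
    show "abs_cont_on {s..t} x" by (rule abs_cont_on_subset[OF x_ac]) (use assms in auto)
    fix r assume "r \<in> {s..t} - N"
    then have "(x has_vector_derivative Fp F (p r) (x r)) (at r within {s..t})"
      by (intro has_vector_derivative_within_subset[OF N(2)]) (use assms in auto)
    then show "(x has_vector_derivative field r (x r)) (at r within {s..t})"
      using assms \<open>r \<in> {s..t} - N\<close> by (simp add: field_def min_def)
  qed
qed

text \<open>The differential equation for \<open>x\<close>, given almost everywhere, holds at every
  time: \<open>x\<close> is the integral of its velocity, and that velocity is continuous along
  \<open>x\<close>.\<close>

lemma x_deriv:
  assumes t: "t \<in> {0..T}"
  shows "(x has_vector_derivative field t (x t)) (at t within {0..T})"
proof -
  have "((\<lambda>t. x 0 + integral {0..t} (\<lambda>r. field r (x r))) has_vector_derivative field t (x t)) (at t within {0..T})"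
    using integral_has_vector_derivative[OF field_compose_cont[OF x_cont] t]
    by (auto intro!: derivative_eq_intros)
  then show ?thesis
    by (rule has_vector_derivative_transform[rotated 2])
       (use t in \<open>auto simp: integral_unique[OF x_integral]\<close>)
qed

lemma speed_bound:
  obtains M where "M \<ge> 0" "\<And>t. t \<in> {0..T} \<Longrightarrow> norm (field t (x t)) \<le> M"
    "\<And>s t. s \<in> {0..T} \<Longrightarrow> t \<in> {0..T} \<Longrightarrow> norm (x t - x s) \<le> M * \<bar>t - s\<bar>"
proof -
  have "bounded ((\<lambda>t. field t (x t)) ` {0..T})"
    by (intro compact_imp_bounded compact_continuous_image field_compose_cont x_cont) simp_all
  then obtain M where M: "\<And>t. t \<in> {0..T} \<Longrightarrow> norm (field t (x t)) \<le> M" unfolding bounded_iff by blast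
  have "0 \<le> M" using M[of 0] T_pos norm_ge_zero order_trans by (metis atLeastAtMost_iff less_imp_le order_refl)
  with M that has_vector_derivative_imp_lipschitz[OF x_deriv M] show thesis by blast
qed

lemma costate_bound:
  obtains P where "P \<ge> 0" "\<And>t. t \<in> {0..T} \<Longrightarrow> norm (p t) \<le> P"
proof -
  have "bounded (p ` {0..T})"
    by (intro compact_imp_bounded compact_continuous_image abs_cont_on_imp_continuous_on p_ac) simp
  then obtain P where P: "\<And>t. t \<in> {0..T} \<Longrightarrow> norm (p t) \<le> P" unfolding bounded_iff by blast
  have "0 \<le> P" using P[of 0] T_pos norm_ge_zero order_trans by (metis atLeastAtMost_iff less_imp_le order_refl)
  with P that show thesis by blast
qed

text \<open>Along \<open>z = y - x\<close> one has
  \<open>d/dt \<langle>p,z\<rangle> = \<langle>p',z\<rangle> + H(y,p) - H(x,p)\<close>, and semiconvexity of \<open>H(\<cdot>,p)\<close> bounds this below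
  because \<open>- p'\<close> is a Clarke gradient.\<close>

lemma costate_pairing_increment:
  assumes t0: "0 \<le> t0" "t0 \<le> T"
    and y: "\<And>t. t \<in> {t0..T} \<Longrightarrow> (y has_vector_derivative field t (y t)) (at t within {t0..T})"
    and near: "\<And>t. t \<in> {t0..T} \<Longrightarrow> norm (y t - x t) \<le> E"
    and P: "\<And>t. t \<in> {0..T} \<Longrightarrow> norm (p t) \<le> P"
  shows "p t0 \<bullet> (y t0 - x t0) - c0 * P * E\<^sup>2 * (T - t0) \<le> p T \<bullet> (y T - x T)"
proof -
  have sub: "{t0..T} \<subseteq> {0..T}" using t0 by auto
  have xd: "(x has_vector_derivative field t (x t)) (at t within {t0..T})" if "t \<in> {t0..T}" for t
    using has_vector_derivative_within_subset[OF x_deriv sub] that sub by blast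
  define z where "z t = y t - x t" for t
  have zd: "(z has_vector_derivative (field t (y t) - field t (x t))) (at t within {t0..T})" if "t \<in> {t0..T}" for t
    unfolding z_def by (intro derivative_intros y xd that)
  have E: "0 \<le> E" using near[of T] t0 norm_ge_zero order_trans by (metis atLeastAtMost_iff order_refl)
  have P0: "0 \<le> P" using P[of T] T_pos norm_ge_zero order_trans by (metis atLeastAtMost_iff less_imp_le order_refl)
  have zlip: "norm (z t - z s) \<le> K1 * E * \<bar>t - s\<bar>" if "s \<in> {t0..T}" "t \<in> {t0..T}" for s t
  proof (rule has_vector_derivative_imp_lipschitz[OF zd _ that])
    fix r assume r: "r \<in> {t0..T}"
    show "norm (field r (y r) - field r (x r)) \<le> K1 * E"
      using field_lip[of r "y r" "x r"] mult_left_mono[OF near[OF r] K1_nonneg] r t0 by auto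
  qed
  have pac: "abs_cont_on {t0..T} p" by (rule abs_cont_on_subset[OF p_ac sub])
  have "abs_cont_on {t0..T} (\<lambda>t. p t \<bullet> z t)"
  proof (rule abs_cont_on_dominated[OF pac abs_cont_on_lipschitz[OF zlip], where B=E and C=P])
    fix s t assume st: "s \<in> {t0..T}" "t \<in> {t0..T}"
    have "p t \<bullet> z t - p s \<bullet> z s = (p t - p s) \<bullet> z t + p s \<bullet> (z t - z s)"
      by (simp add: inner_diff_left inner_diff_right)
    also have "norm \<dots> \<le> norm (p t - p s) * norm (z t) + norm (p s) * norm (z t - z s)"
      using Cauchy_Schwarz_ineq2[of "p t - p s" "z t"] Cauchy_Schwarz_ineq2[of "p s" "z t - z s"] by simp
    also have "\<dots> \<le> norm (p t - p s) * E + P * norm (z t - z s)"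
      using near[OF st(2)] P[of s] st sub by (intro add_mono mult_left_mono mult_right_mono) (auto simp: z_def)
    finally show "norm (p t \<bullet> z t - p s \<bullet> z s) \<le> E * norm (p t - p s) + P * norm (z t - z s)"
      by (simp add: mult.commute)
  qed
  moreover obtain N where N: "negligible N" "\<And>t. t \<in> {0..T} - N \<Longrightarrow>
      \<exists>w. (p has_vector_derivative w) (at t within {0..T}) \<and> - w \<in> clarke_grad (\<lambda>y. Ham F y (p t)) (x t)"
    using adjoint by blast
  then obtain w where w: "\<And>t. t \<in> {0..T} - N \<Longrightarrow> (p has_vector_derivative w t) (at t within {0..T})"
      "\<And>t. t \<in> {0..T} - N \<Longrightarrow> - w t \<in> clarke_grad (\<lambda>y. Ham F y (p t)) (x t)" by metis
  \<comment> \<open>On \<open>N\<close> the integrand is set to the lower bound itself, so that the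
    comparison of integrals may be made at every point.\<close>
  define g where "g t = (if t \<in> N then - (c0 * P * E\<^sup>2) else p t \<bullet> (field t (y t) - field t (x t)) + w t \<bullet> z t)" for t
  have "((\<lambda>t. p t \<bullet> z t) has_vector_derivative g t) (at t within {t0..T})" if "t \<in> {t0..T} - N" for t
  proof -
    have "(p has_vector_derivative w t) (at t within {t0..T})"
      using has_vector_derivative_within_subset[OF w(1) sub] that sub by blast
    moreover have "(z has_vector_derivative (field t (y t) - field t (x t))) (at t within {t0..T})" using zd that by blast
    ultimately show ?thesis
      using bounded_bilinear.has_vector_derivative[OF bounded_bilinear_inner] that by (simp add: g_def)
  qed
  ultimately have int: "(g has_integral (p T \<bullet> z T - p t0 \<bullet> z t0)) {t0..T}"
    using abs_cont_on_fundamental_theorem[OF t0(2) _ N(1), of "\<lambda>t. p t \<bullet> z t" g] by blast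
  have "- (c0 * P * E\<^sup>2) \<le> g t" if t: "t \<in> {t0..T}" for t
  proof (cases "t \<in> N")
    case False
    then have tN: "t \<in> {0..T} - N" and t0': "t \<ge> 0" "t \<le> T" using t t0 by auto
    then have nz: "p t \<noteq> 0" by (intro p_nz) auto
    have "Ham F (x t) (p t) + (- w t) \<bullet> z t - c0 * norm (p t) * (norm (z t))\<^sup>2 \<le> Ham F (x t + z t) (p t)"
      by (rule clarke_grad_semiconvex[OF semiconvex w(2)[OF tN]])
    moreover have "c0 * norm (p t) * (norm (z t))\<^sup>2 \<le> c0 * P * E\<^sup>2"
      using near[OF t] P[of t] tN c0_nonneg P0 by (intro mult_mono power_mono) (auto simp: z_def)
    moreover have "p t \<bullet> (field t (y t) - field t (x t)) = Ham F (y t) (p t) - Ham F (x t) (p t)"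
      using inner_Fp_eq[OF nz] t0' by (simp add: inner_diff_right field_def min_def)
    ultimately show ?thesis using False by (simp add: g_def z_def)
  qed (simp add: g_def)
  from has_integral_le[OF has_integral_const_real[of "- (c0 * P * E\<^sup>2)" t0 T] int this] t0
  show ?thesis by (simp add: z_def mult.commute)
qed

text \<open>If \<open>H(x T, \<xi>) < 0\<close>, every admissible velocity at \<open>x T\<close> points out of the target, so the arc would
  already lie in the interior of the target shortly before \<open>T\<close>.\<close>

lemma Ham_normal_nonneg:
  assumes \<xi>: "\<And>y. y \<notin> S \<Longrightarrow> \<xi> \<bullet> (y - x T) \<le> \<sigma> * (norm (y - x T))\<^sup>2"
    and out: "\<And>t. 0 \<le> t \<Longrightarrow> t < T \<Longrightarrow> x t \<notin> S"
  shows "Ham F (x T) \<xi> \<ge> 0"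
proof (rule ccontr)
  assume neg: "\<not> Ham F (x T) \<xi> \<ge> 0"
  have T: "T \<in> {0..T}" using T_pos by simp
  define v where "v = field T (x T)"
  have v: "\<xi> \<bullet> v < 0"
    using inner_le_Ham[where F=F and y="x T" and q=\<xi>, OF F_compact field_in[of T]] neg T_pos
    unfolding v_def by simp
  have z: "((\<lambda>t. x t - x T) has_vector_derivative v) (at T within {0..T})"
    unfolding v_def using x_deriv[OF T] by (auto intro!: derivative_eq_intros)
  \<comment> \<open>The slack in the proximal inequality along \<open>x\<close>. The quadratic term
    has zero derivative at \<open>T\<close>, so \<phi> has slope
    \<open>\<xi> \<bullet> v < 0\<close> there and is positive just before \<open>T\<close>,
    although \<open>x\<close> is still outside the target.\<close>
  define \<phi> where "\<phi> t = \<xi> \<bullet> (x t - x T) - \<sigma> * ((x t - x T) \<bullet> (x t - x T))" for t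
  have "((\<lambda>t. (x t - x T) \<bullet> (x t - x T)) has_vector_derivative (x T - x T) \<bullet> v + v \<bullet> (x T - x T)) (at T within {0..T})"
    by (rule bounded_bilinear.has_vector_derivative[OF bounded_bilinear_inner z z])
  then have "((\<lambda>t. (x t - x T) \<bullet> (x t - x T)) has_real_derivative 0) (at T within {0..T})"
    by (simp add: has_real_derivative_iff_has_vector_derivative)
  moreover have "((\<lambda>t. \<xi> \<bullet> (x t - x T)) has_real_derivative \<xi> \<bullet> v) (at T within {0..T})"
    unfolding has_real_derivative_iff_has_vector_derivative
    by (rule bounded_linear.has_vector_derivative[OF bounded_linear_inner_right z])
  ultimately have "(\<phi> has_real_derivative \<xi> \<bullet> v) (at T within {0..T})"
    unfolding \<phi>_def by (auto intro!: derivative_eq_intros)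
  from has_real_derivative_neg_dec_left[OF this v] obtain d
    where d: "d > 0" "\<And>h. h > 0 \<Longrightarrow> T - h \<in> {0..T} \<Longrightarrow> h < d \<Longrightarrow> \<phi> T < \<phi> (T - h)" by blast
  define h where "h = min (d / 2) T"
  have h: "h > 0" "T - h \<in> {0..T}" "h < d" using d(1) T_pos by (auto simp: h_def)
  from d(2)[OF h] have "\<phi> (T - h) > 0" by (simp add: \<phi>_def)
  moreover have "\<phi> (T - h) \<le> 0"
    using \<xi>[OF out[of "T - h"]] h by (simp add: \<phi>_def power2_norm_eq_inner)
  ultimately show False by simp
qed

text \<open>Terminal part of the estimate: between \<open>T\<close> and \<open>r\<close> the component of \<open>y\<close> along
  \<open>\<xi>\<close> grows at rate \<open>H(y,\<xi>)\<close> after \<open>T\<close> (where the costate is parallel to \<open>\<xi>\<close>)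
  and at most at that rate before \<open>T\<close>.\<close>

lemma terminal_increment:
  assumes lam: "lam > 0" "lam *\<^sub>R p T = \<xi>" and \<xi>: "norm \<xi> = 1"
    and t0: "0 \<le> t0" "t0 \<le> T" "t0 \<le> r" "max T r \<le> b"
    and y: "\<And>t. t \<in> {t0..b} \<Longrightarrow> (y has_vector_derivative field t (y t)) (at t within {t0..b})"
    and near: "\<And>t. t \<in> {min T r..max T r} \<Longrightarrow> norm (y t - x T) \<le> Q"
  shows "Ham F (x T) \<xi> * (r - T) - K * Q * \<bar>r - T\<bar> \<le> \<xi> \<bullet> (y r - y T)"
proof -
  have H: "\<bar>Ham F (y t) \<xi> - Ham F (x T) \<xi>\<bar> \<le> K * Q" if t: "t \<in> {min T r..max T r}" for t
  proof -
    have "K * norm (y t - x T) \<le> K * Q" using K_pos by (intro mult_left_mono near t) auto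
    then show ?thesis
      using Ham_le_Ham[of "y t" \<xi> "x T"] Ham_le_Ham[of "x T" \<xi> "y t"] \<xi>
      by (simp add: norm_minus_commute abs_le_iff)
  qed
  have der: "((\<lambda>t. \<xi> \<bullet> y t) has_vector_derivative \<xi> \<bullet> field t (y t)) (at t within A)"
    if "t \<in> A" "A \<subseteq> {t0..b}" for t A
    using has_vector_derivative_within_subset[OF y that(2)] that
    by (intro bounded_linear.has_vector_derivative[OF bounded_linear_inner_right]) blast
  show ?thesis
  proof (cases "T \<le> r")
    case True
    have "(Ham F (x T) \<xi> - K * Q) * (r - T) \<le> \<xi> \<bullet> y r - \<xi> \<bullet> y T"
    proof (rule increment_ge_of_derivative_ge[OF True der])
      fix t assume t: "t \<in> {T..r}"
      then have "\<xi> \<bullet> field t (y t) = lam * Ham F (y t) (p T)"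
        using inner_Fp_eq[of "p T" "y t"] p_nz[of T] T_pos lam(2) by (auto simp: field_def)
      also have "\<dots> = Ham F (y t) \<xi>"
        using Ham_scaleR[where F=F and y="y t" and c=lam and q="p T", OF F_compact F_ne] lam by simp
      finally show "Ham F (x T) \<xi> - K * Q \<le> \<xi> \<bullet> field t (y t)" using H[of t] t True by auto
    qed (use t0 True in auto)
    then show ?thesis using True by (simp add: algebra_simps inner_diff_right)
  next
    case False
    \<comment> \<open>The growth rate is bounded only from above before \<open>T\<close>, which is
      the right direction here: the interval runs from \<open>r\<close> to \<open>T\<close>, and
      passing back to \<open>r\<close> loses at most that much.\<close>
    have "- (Ham F (x T) \<xi> + K * Q) * (T - r) \<le> - (\<xi> \<bullet> y T) - - (\<xi> \<bullet> y r)"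
    proof (rule increment_ge_of_derivative_ge)
      fix t assume t: "t \<in> {r..T}"
      show "((\<lambda>t. - (\<xi> \<bullet> y t)) has_vector_derivative - (\<xi> \<bullet> field t (y t))) (at t within {r..T})"
        by (intro derivative_intros der) (use t t0 in auto)
      have "\<xi> \<bullet> field t (y t) \<le> Ham F (y t) \<xi>"
        by (rule inner_le_Ham[where F=F and y="y t", OF F_compact field_in]) (use t t0 in auto)
      then show "- (Ham F (x T) \<xi> + K * Q) \<le> - (\<xi> \<bullet> field t (y t))" using H[of t] t False by auto
    qed (use False in auto)
    then show ?thesis using False by (simp add: algebra_simps inner_diff_right)
  qed
qed

text \<open>Initial displacement and change of terminal time perturb the arc linearly, with
  \<open>G\<close> independent of \<open>t0\<close>, \<open>r\<close> and \<open>y0\<close>. The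
  last clause measures from the fixed endpoint \<open>x T\<close>, as the terminal estimate
  requires.\<close>

lemma perturbed_trajectory:
  obtains G where "G \<ge> 1"
    "\<And>t0 r y0. 0 \<le> t0 \<Longrightarrow> t0 \<le> T \<Longrightarrow> t0 \<le> r \<Longrightarrow> r \<le> T + 1 \<Longrightarrow>
      \<exists>y. y t0 = y0
        \<and> (\<forall>t\<in>{t0..max T r}. (y has_vector_derivative field t (y t)) (at t within {t0..max T r}))
        \<and> (\<forall>t\<in>{t0..T}. norm (y t - x t) \<le> G * (norm (y0 - x t0) + \<bar>r - T\<bar>))
        \<and> (\<forall>t\<in>{min T r..max T r}. norm (y t - x T) \<le> G * (norm (y0 - x t0) + \<bar>r - T\<bar>))"
proof -
  obtain M where M: "M \<ge> 0" "\<And>t. t \<in> {0..T} \<Longrightarrow> norm (field t (x t)) \<le> M"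
    "\<And>s t. s \<in> {0..T} \<Longrightarrow> t \<in> {0..T} \<Longrightarrow> norm (x t - x s) \<le> M * \<bar>t - s\<bar>"
    using speed_bound by blast
  \<comment> \<open>The Picard lemma asks for a positive Lipschitz constant, and \<open>K1\<close>
    may be 0.\<close>
  define L where "L = K1 + 1"
  have L: "L > 0" using K1_nonneg by (simp add: L_def)
  \<comment> \<open>Picard's bound \<open>2 * \<epsilon> * exp (2 * L * (b - t0))\<close> with
    \<epsilon> at most \<open>(M + 1) * D\<close> and \<open>b - t0\<close> at most
    \<open>T + 1\<close>. The further \<open>M\<close> in \<open>G\<close> pays for the motion of
    \<open>x\<close> between \<open>r\<close> and \<open>T\<close>.\<close>
  define G0 where "G0 = 2 * (M + 1) * exp (2 * L * (T + 1))"
  define G where "G = G0 + M"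
  have "1 \<le> exp (2 * L * (T + 1))" using L T_pos by simp
  then have "2 * (M + 1) * 1 \<le> G0" unfolding G0_def using M(1) by (intro mult_left_mono) auto
  then have G1: "G \<ge> 1" "G0 \<le> G" "0 \<le> G0" using M(1) by (auto simp: G_def)
  show thesis
  proof (rule that[OF G1(1)])
    fix t0 r y0 assume t0: "0 \<le> t0" "t0 \<le> T" "t0 \<le> r" "r \<le> T + 1"
    define b where "b = max T r"
    define D where "D = norm (y0 - x t0) + \<bar>r - T\<bar>"
    define \<epsilon> where "\<epsilon> = norm (y0 - x t0) + M * \<bar>r - T\<bar>"
    \<comment> \<open>The approximate solution is \<open>x\<close>, standing still at
      \<open>x T\<close> after \<open>T\<close>.\<close>
    define w where "w t = x (min t T)" for t
    have b: "t0 \<le> b" "b \<le> T + 1" "T \<le> b" "b - T \<le> \<bar>r - T\<bar>" using t0 T_pos by (auto simp: b_def)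
    have wcont: "continuous_on {t0..b} w"
      unfolding w_def using t0 T_pos by (intro continuous_on_compose2[OF x_cont] continuous_intros) auto
    have fw: "continuous_on {t0..b} (\<lambda>s. field s (w s))"
      by (rule field_compose_cont[OF wcont t0(1)])
    have int: "((\<lambda>s. field s (w s)) has_integral (x t - x t0)) {t0..t}" if "t0 \<le> t" "t \<le> T" for t
      by (rule has_integral_eq[OF _ x_integral[OF t0(1) that]]) (use that in \<open>auto simp: w_def min_def\<close>)
    \<comment> \<open>Up to \<open>T\<close> the residual is the initial displacement alone. Beyond
      \<open>T\<close> the arc \<open>w\<close> rests while the field still drifts, at speed at most
      \<open>M\<close>.\<close>
    have res: "norm (w t - (y0 + integral {t0..t} (\<lambda>s. field s (w s)))) \<le> \<epsilon>" if t: "t \<in> {t0..b}" for t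
    proof (cases "t \<le> T")
      case True
      then have "integral {t0..t} (\<lambda>s. field s (w s)) = x t - x t0" using int t by (intro integral_unique) auto
      then show ?thesis using True M(1) by (simp add: w_def \<epsilon>_def norm_minus_commute)
    next
      case False
      have i: "(\<lambda>s. field s (w s)) integrable_on {t0..t}"
        by (intro integrable_continuous_real continuous_on_subset[OF fw]) (use t in auto)
      have i2: "((\<lambda>s. field T (x T)) has_integral (t - T) *\<^sub>R field T (x T)) {T..t}"
        using has_integral_const_real[of "field T (x T)" T t] False by simp
      have "((\<lambda>s. field s (w s)) has_integral (t - T) *\<^sub>R field T (x T)) {T..t}"
        by (rule has_integral_eq[OF _ i2]) (auto simp: w_def field_def min_def)
      with int[of T] t0 False have "((\<lambda>s. field s (w s)) has_integral (x T - x t0) + (t - T) *\<^sub>R field T (x T)) {t0..t}"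
        by (intro has_integral_combine[of t0 T t]) auto
      then have "w t - (y0 + integral {t0..t} (\<lambda>s. field s (w s))) = (x t0 - y0) - (t - T) *\<^sub>R field T (x T)"
        using False by (simp add: integral_unique w_def)
      also have "norm \<dots> \<le> norm (x t0 - y0) + \<bar>t - T\<bar> * norm (field T (x T))"
        by (metis norm_scaleR norm_triangle_ineq4)
      also have "\<dots> \<le> norm (x t0 - y0) + \<bar>r - T\<bar> * M"
        using M(2)[of T] T_pos M(1) t b False by (intro add_mono mult_mono) auto
      finally show ?thesis by (simp add: \<epsilon>_def norm_minus_commute mult.commute)
    qed
    have lip: "norm (field t y - field t z) \<le> L * norm (y - z)" if "t \<in> {t0..b}" for t y z
      using field_lip[of t y z] that t0 by (simp add: L_def distrib_right add_increasing2)
    have fc: "continuous_on {t0..b} (\<lambda>t. field t y)" for y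
      by (rule continuous_on_subset[OF field_cont]) (use t0 in auto)
    obtain y where y: "y t0 = y0"
      "\<And>t. t \<in> {t0..b} \<Longrightarrow> (y has_vector_derivative field t (y t)) (at t within {t0..b})"
      "\<And>t. t \<in> {t0..b} \<Longrightarrow> norm (y t - w t) \<le> 2 * \<epsilon> * exp (2 * L * (b - t0))"
      using picard_near_approximate_solution[OF b(1) L lip fc wcont res] by blast
    have D0: "D \<ge> 0" by (simp add: D_def)
    have near: "norm (y t - w t) \<le> G0 * D" if "t \<in> {t0..b}" for t
    proof -
      have "\<epsilon> \<le> (M + 1) * D" using M(1) by (simp add: \<epsilon>_def D_def algebra_simps)
      moreover have "0 \<le> \<epsilon>" using M(1) by (simp add: \<epsilon>_def)
      moreover have "exp (2 * L * (b - t0)) \<le> exp (2 * L * (T + 1))" using L b t0 by simp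
      ultimately have "2 * \<epsilon> * exp (2 * L * (b - t0)) \<le> 2 * ((M + 1) * D) * exp (2 * L * (T + 1))"
        by (intro mult_mono) auto
      also have "\<dots> = G0 * D" by (simp add: G0_def)
      finally show ?thesis using y(3)[OF that] by linarith
    qed
    have GD: "G0 * D \<le> G * D" using G1 D0 by (intro mult_right_mono) auto
    have "norm (y t - x t) \<le> G * D" if "t \<in> {t0..T}" for t
      using near[of t] that b GD by (simp add: w_def)
    moreover have "norm (y t - x T) \<le> G * D" if t: "t \<in> {min T r..max T r}" for t
    proof -
      have t': "t \<in> {t0..b}" using t t0 by (auto simp: b_def)
      have "\<bar>min t T - T\<bar> \<le> \<bar>r - T\<bar>" using t by (auto simp: min_def max_def split: if_splits)
      also have "\<dots> \<le> D" by (simp add: D_def)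
      finally have "norm (w t - x T) \<le> M * D"
        using M(3)[of T "min t T"] mult_left_mono[of "\<bar>min t T - T\<bar>" D M] M(1) t' t0 T_pos by (auto simp: w_def)
      moreover have "norm (y t - x T) \<le> norm (y t - w t) + norm (w t - x T)"
        using norm_triangle_ineq[of "y t - w t" "w t - x T"] by simp
      ultimately show ?thesis using near[OF t'] by (simp add: G_def distrib_right)
    qed
    ultimately show "\<exists>y. y t0 = y0
        \<and> (\<forall>t\<in>{t0..max T r}. (y has_vector_derivative field t (y t)) (at t within {t0..max T r}))
        \<and> (\<forall>t\<in>{t0..T}. norm (y t - x t) \<le> G * (norm (y0 - x t0) + \<bar>r - T\<bar>))
        \<and> (\<forall>t\<in>{min T r..max T r}. norm (y t - x T) \<le> G * (norm (y0 - x t0) + \<bar>r - T\<bar>))"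
      using y(1,2) unfolding D_def b_def by blast
  qed
qed

text \<open>By continuity an arc that is interior to \<open>S\<close> at time \<open>r\<close> is in
  \<open>S\<close> already slightly earlier. This makes the inequality strict, as needed to
  contradict membership in the hypograph.\<close>

lemma min_time_less_of_interior:
  assumes t0: "0 \<le> t0" "t0 < r" "r \<le> b"
    and y: "\<And>t. t \<in> {t0..b} \<Longrightarrow> (y has_vector_derivative field t (y t)) (at t within {t0..b})"
    and int: "y r \<in> interior S"
  shows "min_time F S (y t0) < ereal (r - t0)"
proof -
  have ycont: "continuous_on {t0..b} y"
    using y has_vector_derivative_continuous continuous_on_eq_continuous_within by blast
  obtain e where e: "e > 0" "ball (y r) e \<subseteq> S" using int by (auto simp: mem_interior)
  obtain d where d: "d > 0" "\<And>s. s \<in> {t0..b} \<Longrightarrow> dist s r < d \<Longrightarrow> dist (y s) (y r) < e"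
    using ycont e(1) t0 unfolding continuous_on_iff by (metis atLeastAtMost_iff less_imp_le)
  \<comment> \<open>The midpoint keeps \<open>s\<close> strictly after \<open>t0\<close>; the other
    entry keeps it within \<open>d\<close> of \<open>r\<close>.\<close>
  define s where "s = max ((t0 + r) / 2) (r - d / 2)"
  have s: "t0 < s" "s < r" "r - d / 2 \<le> s" using t0 d(1) by (auto simp: s_def max_def)
  then have "dist s r < d" using d(1) by (simp add: dist_real_def)
  with s have yS: "y s \<in> S" using d(2)[of s] e(2) t0 by (auto simp: dist_commute)
  have fc: "continuous_on {t0..b} (\<lambda>t. field t (y t))" by (rule field_compose_cont[OF ycont t0(1)])
  have "trajectory_on F (s - t0) (\<lambda>t. y (t + t0))"
    by (rule trajectory_on_C1[OF y fc]) (use s t0 field_in in auto)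
  from min_time_le[OF _ this, of S] s yS have "min_time F S (y t0) \<le> ereal (s - t0)" by simp
  also have "\<dots> < ereal (r - t0)" using s by simp
  finally show ?thesis .
qed

text \<open>Both parts of the theorem at once: with \<open>lam = H(x T, \<xi>)\<close> this is (a multiple of) a proximal
  supergradient inequality, with \<open>lam = 1\<close> and \<open>H(x T, \<xi>) = 0\<close> a horizontal one.\<close>

lemma hypograph_normal:
  assumes \<xi>: "\<And>y. y \<notin> interior S \<Longrightarrow> \<xi> \<bullet> (y - x T) \<le> \<sigma> * (norm (y - x T))\<^sup>2"
    and \<sigma>: "\<sigma> \<ge> 0" and unit: "norm \<xi> = 1"
    and lam: "lam > 0" "lam *\<^sub>R p T = \<xi>"
    and t0: "0 \<le> t0" "t0 < T"
    and time: "min_time F S (x t0) = ereal (T - t0)"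
  shows "(lam *\<^sub>R p t0, Ham F (x T) \<xi>) \<in> prox_normal (hypo (min_time F S)) (x t0, T - t0)"
proof -
  obtain G where G: "G \<ge> 1" and traj: "\<And>t0 r y0. 0 \<le> t0 \<Longrightarrow> t0 \<le> T \<Longrightarrow> t0 \<le> r \<Longrightarrow> r \<le> T + 1 \<Longrightarrow>
      \<exists>y. y t0 = y0
        \<and> (\<forall>t\<in>{t0..max T r}. (y has_vector_derivative field t (y t)) (at t within {t0..max T r}))
        \<and> (\<forall>t\<in>{t0..T}. norm (y t - x t) \<le> G * (norm (y0 - x t0) + \<bar>r - T\<bar>))
        \<and> (\<forall>t\<in>{min T r..max T r}. norm (y t - x T) \<le> G * (norm (y0 - x t0) + \<bar>r - T\<bar>))"
    using perturbed_trajectory by blast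
  obtain P where P: "P \<ge> 0" "\<And>t. t \<in> {0..T} \<Longrightarrow> norm (p t) \<le> P" using costate_bound by blast
  \<comment> \<open>The three quadratic errors: semiconvexity along the arc, the terminal piece, and
    the proximal normal to the target.\<close>
  define A where "A = lam * c0 * P * T + K + \<sigma>"
  have A: "A \<ge> 0" using lam P(1) c0_nonneg T_pos K_pos \<sigma> by (simp add: A_def)
  \<comment> \<open>The bound 1 keeps \<open>r\<close> below \<open>T + 1\<close>, and
    \<open>T - t0\<close> keeps it after \<open>t0\<close>.\<close>
  define \<delta> where "\<delta> = min 1 (T - t0)"
  have \<delta>: "\<delta> > 0" "\<delta> \<le> 1" "\<delta> \<le> T - t0" using t0 by (auto simp: \<delta>_def)
  show ?thesis
  proof (rule prox_normal_localI[where \<delta>=\<delta> and C="2 * A * G\<^sup>2"])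
    show "(x t0, T - t0) \<in> hypo (min_time F S)" using time by (simp add: hypo_def)
    fix z assume z: "z \<in> hypo (min_time F S)" and close: "norm (z - (x t0, T - t0)) < \<delta>"
    obtain y0 \<alpha> where z_eq: "z = (y0, \<alpha>)" by (cases z)
    define \<theta> where "\<theta> = \<alpha> - (T - t0)"
    \<comment> \<open>The perturbed arc from \<open>y0\<close> is run for exactly the time \<alpha>;
      its terminal time differs from \<open>T\<close> by \<theta>.\<close>
    define r where "r = t0 + \<alpha>"
    have r: "r - T = \<theta>" by (simp add: r_def \<theta>_def)
    define D where "D = norm (y0 - x t0)"
    have nz: "(norm (z - (x t0, T - t0)))\<^sup>2 = D\<^sup>2 + \<theta>\<^sup>2"
      by (simp add: z_eq norm_Pair D_def \<theta>_def)
    have "\<bar>\<theta>\<bar> \<le> norm (z - (x t0, T - t0))"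
      using norm_snd_le[of "\<alpha> - (T - t0)" "y0 - x t0"] by (simp add: z_eq \<theta>_def)
    then have \<theta>: "\<bar>\<theta>\<bar> < \<delta>" using close by simp
    then have rb: "t0 < r" "r \<le> T + 1" using \<delta> r by linarith+
    define Q where "Q = G * (D + \<bar>\<theta>\<bar>)"
    obtain y where y: "y t0 = y0"
      "\<And>t. t \<in> {t0..max T r} \<Longrightarrow> (y has_vector_derivative field t (y t)) (at t within {t0..max T r})"
      "\<And>t. t \<in> {t0..T} \<Longrightarrow> norm (y t - x t) \<le> Q"
      "\<And>t. t \<in> {min T r..max T r} \<Longrightarrow> norm (y t - x T) \<le> Q"
      using traj[of t0 r y0] t0 rb unfolding Q_def D_def r by force
    have "D \<ge> 0" by (simp add: D_def)
    then have \<theta>Q: "\<bar>\<theta>\<bar> \<le> Q" using mult_right_mono[OF G, of "D + \<bar>\<theta>\<bar>"] by (simp add: Q_def)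
    then have Q0: "Q \<ge> 0" by simp
    \<comment> \<open>Here the hypograph enters: \<alpha> is at most the minimum time from
      \<open>y0\<close>, so the arc cannot be interior to the target at time \<alpha>. An infinite
      minimum time is covered as well.\<close>
    have "y r \<notin> interior S"
    proof
      assume "y r \<in> interior S"
      from min_time_less_of_interior[OF t0(1) rb(1) _ y(2) this] y(1)
      have "min_time F S y0 < ereal \<alpha>" by (simp add: r_def)
      moreover have "ereal \<alpha> \<le> min_time F S y0" using z by (simp add: hypo_def z_eq)
      ultimately show False by simp
    qed
    then have "\<xi> \<bullet> (y r - x T) \<le> \<sigma> * (norm (y r - x T))\<^sup>2" by (rule \<xi>)
    also have "\<dots> \<le> \<sigma> * Q\<^sup>2"
      using y(4)[of r] \<sigma> by (intro mult_left_mono power_mono) auto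
    finally have fin: "\<xi> \<bullet> (y r - x T) \<le> \<sigma> * Q\<^sup>2" .
    have tinc: "Ham F (x T) \<xi> * \<theta> - K * Q * \<bar>\<theta>\<bar> \<le> \<xi> \<bullet> (y r - y T)"
      using terminal_increment[OF lam unit t0(1) _ _ order_refl y(2,4)] t0 rb r by simp
    have "p t0 \<bullet> (y0 - x t0) - c0 * P * Q\<^sup>2 * (T - t0) \<le> p T \<bullet> (y T - x T)"
    proof (rule costate_pairing_increment[where y=y, OF t0(1) _ _ y(3) P(2), unfolded y(1)])
      fix t assume "t \<in> {t0..T}"
      then show "(y has_vector_derivative field t (y t)) (at t within {t0..T})"
        using has_vector_derivative_within_subset[OF y(2), of t "{t0..T}"] by auto
    qed (use t0 in auto)
    from mult_left_mono[OF this, of lam] lam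
    have pair: "lam * (p t0 \<bullet> (y0 - x t0)) - lam * (c0 * P * Q\<^sup>2 * (T - t0)) \<le> \<xi> \<bullet> (y T - x T)"
      by (simp add: right_diff_distrib inner_scaleR_left[symmetric] del: inner_scaleR_left)
    have "lam * (c0 * P * Q\<^sup>2 * (T - t0)) \<le> lam * (c0 * P * Q\<^sup>2 * T)"
      using lam c0_nonneg P(1) t0 by (intro mult_left_mono) auto
    moreover have "K * Q * \<bar>\<theta>\<bar> \<le> K * Q * Q" using \<theta>Q K_pos Q0 by (intro mult_left_mono) auto
    moreover have "\<xi> \<bullet> (y r - x T) = \<xi> \<bullet> (y r - y T) + \<xi> \<bullet> (y T - x T)" by (simp add: inner_diff_right)
    ultimately have "lam * (p t0 \<bullet> (y0 - x t0)) + Ham F (x T) \<xi> * \<theta> \<le> lam * (c0 * P * Q\<^sup>2 * T) + K * Q * Q + \<sigma> * Q\<^sup>2"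
      using fin tinc pair by linarith
    also have "\<dots> = A * Q\<^sup>2" by (simp add: A_def algebra_simps power2_eq_square)
    also have "\<dots> \<le> A * (G\<^sup>2 * (2 * (D\<^sup>2 + \<theta>\<^sup>2)))"
    proof (intro mult_left_mono A)
      \<comment> \<open>Passes from the sum of the two displacements to the Euclidean product norm,
        at the cost of a factor 2.\<close>
      have "(D + \<bar>\<theta>\<bar>)\<^sup>2 \<le> 2 * (D\<^sup>2 + \<theta>\<^sup>2)"
        using sum_squares_ge_zero[of "D - \<bar>\<theta>\<bar>" 0] by (simp add: power2_eq_square algebra_simps)
      then show "Q\<^sup>2 \<le> G\<^sup>2 * (2 * (D\<^sup>2 + \<theta>\<^sup>2))"
        unfolding Q_def power_mult_distrib by (intro mult_left_mono) auto
    qed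
    also have "\<dots> = 2 * A * G\<^sup>2 * (D\<^sup>2 + \<theta>\<^sup>2)" by (simp only: mult_ac)
    finally show "(lam *\<^sub>R p t0, Ham F (x T) \<xi>) \<bullet> (z - (x t0, T - t0)) \<le> 2 * A * G\<^sup>2 * (norm (z - (x t0, T - t0)))\<^sup>2"
      unfolding nz by (simp add: z_eq \<theta>_def)
  qed (use \<delta> A in auto)
qed

end

section \<open>The normal and the horizontal case\<close>

theorem theorem4p1:
  fixes F :: "'a::euclidean_space \<Rightarrow> 'a set"
    and S :: "'a set" and x0 :: 'a and xi :: 'a
    and x :: "real \<Rightarrow> 'a" and p :: "real \<Rightarrow> 'a" and K :: real
  assumes F_ne: "\<And>y. F y \<noteq> {}"
    and F_convex: "\<And>y. convex (F y)"
    and F_compact: "\<And>y. compact (F y)"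
    and K_pos: "K > 0"
    and F_lip: "\<And>x1 x2. \<forall>v\<in>F x2. \<exists>w\<in>F x1. norm (v - w) \<le> K * norm (x1 - x2)"
    and H1: "\<exists>c0\<ge>0. \<forall>q. semiconvex_with (c0 * norm q) (\<lambda>y. Ham F y q)"
    and H2_diff: "\<And>y q. q \<noteq> 0 \<Longrightarrow> \<exists>g. ((\<lambda>r. Ham F y r) has_derivative (\<lambda>r. g \<bullet> r)) (at q)"
    and H2_lip: "\<exists>K1\<ge>0. \<forall>y z q. q \<noteq> 0 \<longrightarrow> norm (Fp F q y - Fp F q z) \<le> K1 * norm (y - z)"
    and S_closed: "closed S"
    and x0_notin: "x0 \<notin> S"
    and T_fin: "min_time F S x0 < \<infinity>"
    and x_traj: "trajectory_on F (real_of_ereal (min_time F S x0)) x"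
    and x_start: "x 0 = x0"
    and x_end: "x (real_of_ereal (min_time F S x0)) \<in> S"
    and xi_unit: "norm xi = 1"
    and xi_normal: "xi \<in> prox_normal (closure (UNIV - S)) (x (real_of_ereal (min_time F S x0)))"
    and p_ac: "abs_cont_on {0..real_of_ereal (min_time F S x0)} p"
    and p_nz: "\<And>t. t \<in> {0..real_of_ereal (min_time F S x0)} \<Longrightarrow> p t \<noteq> 0"
    and adj: "\<exists>N. negligible N \<and> (\<forall>t \<in> {0..real_of_ereal (min_time F S x0)} - N.
                 (x has_vector_derivative Fp F (p t) (x t)) (at t within {0..real_of_ereal (min_time F S x0)}) \<and>
                 (\<exists>w. (p has_vector_derivative w) (at t within {0..real_of_ereal (min_time F S x0)}) \<and>
                      - w \<in> clarke_grad (\<lambda>y. Ham F y (p t)) (x t)))"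
  shows "(Ham F (x (real_of_ereal (min_time F S x0))) xi \<noteq> 0 \<and>
            p (real_of_ereal (min_time F S x0)) = (1 / Ham F (x (real_of_ereal (min_time F S x0))) xi) *\<^sub>R xi
          \<longrightarrow> (\<forall>t \<in> {0..<real_of_ereal (min_time F S x0)}. - p t \<in> prox_supergrad (min_time F S) (x t)))
       \<and> (Ham F (x (real_of_ereal (min_time F S x0))) xi = 0 \<and>
            p (real_of_ereal (min_time F S x0)) = xi
          \<longrightarrow> (\<forall>t \<in> {0..<real_of_ereal (min_time F S x0)}. - p t \<in> horiz_prox_supergrad (min_time F S) (x t)))"
proof -
  define T where "T = real_of_ereal (min_time F S x0)"
  obtain c0 where c0: "c0 \<ge> 0" "\<And>q. semiconvex_with (c0 * norm q) (\<lambda>y. Ham F y q)" using H1 by blast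
  obtain K1 where K1: "K1 \<ge> 0" "\<And>y z q. q \<noteq> 0 \<Longrightarrow> norm (Fp F q y - Fp F q z) \<le> K1 * norm (y - z)"
    using H2_lip by blast
  have time: "min_time F S (x 0) = ereal T"
    using T_fin min_time_nonneg[of F S x0] unfolding x_start T_def
    by (cases "min_time F S x0") auto
  have "T \<ge> 0" using time min_time_nonneg[of F S "x 0"] by simp
  \<comment> \<open>At time 0 the arc is at \<open>x0\<close>, outside \<open>S\<close>, while at
    time \<open>T\<close> it is in \<open>S\<close>.\<close>
  moreover have "T \<noteq> 0" using x0_notin x_start x_end unfolding T_def by metis
  ultimately have T: "T > 0" by simp
  interpret extremal F K c0 K1 T x p
  proof
    show "abs_cont_on {0..T} x" using x_traj by (simp add: trajectory_on_def T_def)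
  qed (use F_ne F_compact K_pos F_lip c0 H2_diff K1 T p_ac p_nz adj in \<open>auto simp: T_def\<close>)
  obtain \<sigma> where \<sigma>: "\<sigma> \<ge> 0" "\<And>y. y \<in> closure (UNIV - S) \<Longrightarrow> xi \<bullet> (y - x T) \<le> \<sigma> * (norm (y - x T))\<^sup>2"
    using xi_normal unfolding prox_normal_def T_def by blast
  \<comment> \<open>The closure of the complement is the complement of the interior, so the
    inequality also holds at boundary points of \<open>S\<close>.\<close>
  have normal: "xi \<bullet> (y - x T) \<le> \<sigma> * (norm (y - x T))\<^sup>2" if "y \<notin> interior S" for y
    using \<sigma>(2)[of y] that by (simp add: closure_complement flip: Compl_eq_Diff_UNIV)
  have traj: "trajectory_on F T x" and reach: "x T \<in> S" using x_traj x_end by (simp_all add: T_def)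
  have along: "min_time F S (x t) = ereal (T - t)" if "t \<in> {0..<T}" for t
    using min_time_along_optimal[OF time traj reach] that by simp
  have out: "x t \<notin> S" if "0 \<le> t" "t < T" for t
    using not_in_target_before_optimal_time[OF time traj, of t] that x0_notin x_start by (cases "t = 0") auto
  \<comment> \<open>This excludes a negative Hamiltonian, so in the first case it is positive and
    may serve as \<open>lam\<close>.\<close>
  have nonneg: "Ham F (x T) xi \<ge> 0"
    by (rule Ham_normal_nonneg[OF normal out]) (use interior_subset in blast)+
  have "- p t \<in> prox_supergrad (min_time F S) (x t)"
    if h: "Ham F (x T) xi \<noteq> 0" "p T = (1 / Ham F (x T) xi) *\<^sub>R xi" and t: "t \<in> {0..<T}" for t
  proof -
    let ?h = "Ham F (x T) xi"
    have "?h > 0" using nonneg h(1) by simp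
    \<comment> \<open>With \<open>lam = ?h\<close> the terminal condition reads
      \<open>lam *\<^sub>R p T = xi\<close>; dividing the normal by \<open>?h\<close> then gives
      last component 1.\<close>
    have "(?h *\<^sub>R p t, ?h) \<in> prox_normal (hypo (min_time F S)) (x t, T - t)"
      using \<open>?h > 0\<close> h(2) t by (intro hypograph_normal[OF normal \<sigma>(1) xi_unit] along) auto
    from prox_normal_scaleR[OF this, of "1 / ?h"] \<open>?h > 0\<close>
    have "(p t, 1) \<in> prox_normal (hypo (min_time F S)) (x t, T - t)" by simp
    then show ?thesis unfolding prox_supergrad_def by (simp add: along[OF t])
  qed
  moreover have "- p t \<in> horiz_prox_supergrad (min_time F S) (x t)"
    if h: "Ham F (x T) xi = 0" "p T = xi" and t: "t \<in> {0..<T}" for t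
  proof -
    \<comment> \<open>With \<open>lam = 1\<close> the vanishing Hamiltonian is the last component,
      so the normal is horizontal.\<close>
    have "(1 *\<^sub>R p t, Ham F (x T) xi) \<in> prox_normal (hypo (min_time F S)) (x t, T - t)"
      using h(2) t by (intro hypograph_normal[OF normal \<sigma>(1) xi_unit] along) auto
    then show ?thesis unfolding horiz_prox_supergrad_def using h(1) by (simp add: along[OF t])
  qed
  ultimately show ?thesis unfolding T_def[symmetric] by blast
qed

end
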